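(* Let $X$ be a compact metric space and let $\mathbf{K}_X$ be a compact set of probability measures on $\mathrm{Homeo}(X)$. (1) Assume that for every $\mu\in\mathbf{K}_X$ there is no finite set with a deterministic image. Then for any $\varepsilon>0$ there exists $n$ such that for any probability measure $\nu$ on $X$ and any $\mu_1,\dots,\mu_n\in\mathbf{K}_X$ one has $$\mathfrak{Max}(\mu_n*\dots*\mu_1*\nu)<\varepsilon .$$ In particular, for any probability measure $\nu$ on $X$ and any sequence $\mu_1,\mu_2,\dots\in\mathbf{K}_X$ one has $\lim_{n\to\infty}\mathfrak{Max}(\mu_n*\dots*\mu_1*\nu)=0$. (2) If, moreover, for every $\mu\in\mathbf{K}_X$ there is no measure with a deterministic image, then the convergence is exponential and uniform over all sequences $(\mu_i)\in\mathbf{K}_X^{\mathbb{N}}$ and all probability measures $\nu$: there exists $\lambda<1$ such that for any $n\ge1$, any probability measure $\nu$ on $X$ and any $\mu_1,\mu_2,\dots\in\mathbf{K}_X$ $$\mathfrak{Max}(\mu_n*\dots*\mu_1*\nu)<\lambda^n .$$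
   Context: $\mathrm{Homeo}(X)$ is the group of homeomorphisms of $X$ (with the uniform topology), and compactness of $\mathbf{K}_X$ is with respect to weak-$*$ (weak) convergence of probability measures. For a probability measure $\nu$, $\mathfrak{Max}(\nu)$ denotes the weight of a maximal atom of $\nu$, with $\mathfrak{Max}(\nu)=0$ if $\nu$ has no atoms. For a measure $\mu$ on $\mathrm{Homeo}(X)$ and a measure $\nu$ on $X$, $\mu*\nu=\mathbb{E}_\mu f_*\nu$ is the law of $f(x)$, where $f$ and $x$ are chosen independently with respect to $\mu$ and $\nu$. For a probability measure $\mu$ on $\mathrm{Homeo}(X)$ we say that there is: "no finite set with a deterministic image" if there are no two nonempty finite sets $F,F'\subset X$ such that $f(F)=F'$ for $\mu$-a.e. $f$; "no measure with a deterministic image" if there are no two Borel probability measures $\nu,\nu'$ on $X$ such that $f_*\nu=\nu'$ for $\mu$-a.e. $f$. *)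

theory Defs
  imports "HOL-Probability.Probability"
begin

text \<open>
  The type \<open>'a \<Rightarrow>\<^sub>C 'a\<close> carries the supremum metric; for compact \<open>'a\<close> it is the space of all
  continuous self-maps with the uniform topology. \<open>Homeo\<close> is used with the subspace topology. By
  compactness this is also the topology of uniform convergence of maps together with their inverses.
\<close>

definition Homeo :: "('a::metric_space \<Rightarrow>\<^sub>C 'a) set" where
  "Homeo = {f. \<exists>g. homeomorphism UNIV UNIV (apply_bcontfun f) g}"

text \<open>The underlying measurable space is \<open>S\<close> with the Borel algebra of its subspace topology.\<close>

definition borel_prob :: "'b::topological_space set \<Rightarrow> 'b measure set" where
  "borel_prob S = {M. prob_space M \<and> sets M = sets (restrict_space borel S)}"

text \<open>
  The coarsest topology on \<open>borel_prob S\<close> making integration against each bounded continuous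
  real function on \<open>S\<close> continuous.
\<close>

definition weak_topology :: "'b::topological_space set \<Rightarrow> 'b measure topology" where
  "weak_topology S = topology_generated_by
     {{M \<in> borel_prob S. (LINT x|M. \<phi> x) \<in> U} |\<phi> U.
        continuous_on S \<phi> \<and> bounded (\<phi> ` S) \<and> open (U :: real set)}"

text \<open>
  On a compact metric space the atoms of a Borel probability measure are, up to null sets, single
  points, and the supremum is attained; it is \<open>0\<close> exactly when there is no atom.
\<close>

definition max_atom :: "'a measure \<Rightarrow> real" where
  "max_atom \<nu> = (SUP x. measure \<nu> {x})"

lemma max_atom_attained:
  fixes \<nu> :: "'a::metric_space measure"
  assumes "\<nu> \<in> borel_prob UNIV"
  shows "\<exists>x. max_atom \<nu> = measure \<nu> {x} \<and> (\<forall>y. measure \<nu> {y} \<le> measure \<nu> {x})"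
proof -
  interpret prob_space \<nu> using assms by (simp add: borel_prob_def)
  have [simp]: "sets \<nu> = sets borel" using assms by (simp add: borel_prob_def)
  have "\<exists>x. \<forall>y. measure \<nu> {y} \<le> measure \<nu> {x}"
  proof (cases "\<exists>x. measure \<nu> {x} > 0")
    case False
    then show ?thesis by (meson measure_nonneg not_le order_trans)
  next
    case True
    then obtain z where z: "measure \<nu> {z} > 0" by blast
    let ?A = "{x. measure \<nu> {z} \<le> measure \<nu> {x}}"
    have bd: "real (card F) * measure \<nu> {z} \<le> 1" if "finite F" "F \<subseteq> ?A" for F
    proof -
      have "real (card F) * measure \<nu> {z} \<le> (\<Sum>x\<in>F. measure \<nu> {x})"
        using that sum_bounded_below[of F "measure \<nu> {z}" "\<lambda>x. measure \<nu> {x}"] by auto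
      also have "\<dots> = measure \<nu> F"
        using that by (intro finite_measure_eq_sum_singleton[symmetric]) auto
      also have "\<dots> \<le> 1" by simp
      finally show ?thesis .
    qed
    have "finite ?A"
    proof (rule finite_if_finite_subsets_card_bdd[THEN conjunct1, of _ "nat \<lceil>1 / measure \<nu> {z}\<rceil>"])
      fix F assume "F \<subseteq> ?A" "finite F"
      then have "real (card F) \<le> 1 / measure \<nu> {z}" using bd z by (simp add: field_simps)
      then show "card F \<le> nat \<lceil>1 / measure \<nu> {z}\<rceil>" by linarith
    qed
    moreover have "z \<in> ?A" by simp
    ultimately have A: "finite ((\<lambda>x. measure \<nu> {x}) ` ?A)" "(\<lambda>x. measure \<nu> {x}) ` ?A \<noteq> {}"
      by blast+
    obtain x where x: "x \<in> ?A" "measure \<nu> {x} = Max ((\<lambda>x. measure \<nu> {x}) ` ?A)"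
      using Max_in[OF A] by auto
    have "measure \<nu> {y} \<le> measure \<nu> {x}" for y
    proof (cases "y \<in> ?A")
      case True
      then show ?thesis unfolding x(2) using A(1) by (intro Max_ge) auto
    next
      case False
      then show ?thesis using x(1) by auto
    qed
    then show ?thesis by blast
  qed
  then obtain x where x: "\<And>y. measure \<nu> {y} \<le> measure \<nu> {x}" by blast
  then have "max_atom \<nu> = measure \<nu> {x}"
    unfolding max_atom_def by (intro cSup_eq_maximum) auto
  then show ?thesis using x by blast
qed

definition conv :: "('a::metric_space \<Rightarrow>\<^sub>C 'a) measure \<Rightarrow> 'a measure \<Rightarrow> 'a measure" where
  "conv \<mu> \<nu> = distr (\<mu> \<Otimes>\<^sub>M \<nu>) borel (\<lambda>(f, x). apply_bcontfun f x)"

lemma countable_dense_compact: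
  assumes "compact (UNIV :: 'a::metric_space set)"
  obtains D :: "'a::metric_space set" where "countable D" "\<And>x e. e > 0 \<Longrightarrow> \<exists>d\<in>D. dist x d < e"
proof -
  have "\<exists>F. finite F \<and> (UNIV :: 'a set) \<subseteq> (\<Union>x\<in>F. ball x (inverse (Suc n)))" for n :: nat
  proof -
    have "(UNIV :: 'a set) \<subseteq> (\<Union>x\<in>UNIV. ball x (inverse (Suc n)))"
    proof
      fix y :: 'a
      have "y \<in> ball y (inverse (Suc n))" by (simp del: of_nat_Suc)
      then show "y \<in> (\<Union>x\<in>UNIV. ball x (inverse (Suc n)))" by blast
    qed
    from compactE_image[OF assms _ this] show ?thesis by (metis open_ball)
  qed
  then obtain F :: "nat \<Rightarrow> 'a set"
    where F: "finite (F n)" "UNIV \<subseteq> (\<Union>x\<in>F n. ball x (inverse (Suc n)))" for n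
    by metis
  show thesis
  proof (rule that[of "\<Union>n. F n"])
    show "countable (\<Union>n. F n)" using F(1) by (auto intro: countable_finite)
    show "\<exists>d\<in>\<Union>n. F n. dist x d < e" if e: "e > 0" for x e
    proof -
      obtain n where n: "inverse (real (Suc n)) < e" using reals_Archimedean[OF e] by auto
      have "x \<in> (\<Union>x\<in>F n. ball x (inverse (Suc n)))" using F(2)[of n] by blast
      then obtain d where "d \<in> F n" "dist d x < inverse (Suc n)" by auto
      then show ?thesis using n by (intro bexI[of _ d]) (auto simp: dist_commute)
    qed
  qed
qed

lemma measurable_eval:
  fixes \<mu> :: "('a::metric_space \<Rightarrow>\<^sub>C 'a) measure" and \<nu> :: "'a measure"
  assumes "compact (UNIV :: 'a set)"
    and "\<mu> \<in> borel_prob Homeo" and "\<nu> \<in> borel_prob UNIV"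
  shows "(\<lambda>(f, x). apply_bcontfun f x) \<in> borel_measurable (\<mu> \<Otimes>\<^sub>M \<nu>)"
proof -
  have \<mu>[measurable_cong]: "sets \<mu> = sets (restrict_space borel Homeo)"
    and \<nu>[measurable_cong]: "sets \<nu> = sets borel"
    using assms by (auto simp: borel_prob_def)
  obtain D :: "'a set" where D: "countable D" "\<And>x e. e > 0 \<Longrightarrow> \<exists>d\<in>D. dist x d < e"
    using countable_dense_compact[OF assms(1)] by blast
  have "(\<lambda>p. apply_bcontfun (fst p) (snd p)) \<in> borel_measurable (\<mu> \<Otimes>\<^sub>M \<nu>)"
  proof (rule borel_measurableI)
    fix U :: "'a set" assume "open U"
    let ?C = "- U" and ?P = "\<mu> \<Otimes>\<^sub>M \<nu>"
    show "(\<lambda>p. apply_bcontfun (fst p) (snd p)) -` U \<inter> space ?P \<in> sets ?P"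
    proof (cases "?C = {}")
      case True
      then have "U = UNIV" by blast
      then show ?thesis by simp
    next
      case False
      have ev: "apply_bcontfun f x \<in> ?C \<longleftrightarrow> (\<forall>k::nat. \<exists>d\<in>D. dist x d < inverse (real (Suc k)) \<and>
          infdist (apply_bcontfun f d) ?C < inverse (real (Suc k)))" (is "_ = (\<forall>k. ?Q k)") for f :: "'a \<Rightarrow>\<^sub>C 'a" and x
      proof
        assume fx: "f x \<in> ?C"
        show "\<forall>k. ?Q k"
        proof
          fix k :: nat
          let ?e = "inverse (real (Suc k))"
          have "isCont f x"
            using continuous_on_eq_continuous_at[of UNIV "apply_bcontfun f"] by auto
          then obtain \<delta> where \<delta>: "\<delta> > 0" "\<And>y. dist y x < \<delta> \<Longrightarrow> dist (f y) (f x) < ?e"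
            unfolding continuous_at_eps_delta by (metis inverse_positive_iff_positive of_nat_0_less_iff zero_less_Suc)
          obtain d where d: "d \<in> D" "dist x d < min \<delta> ?e"
            using D(2)[of "min \<delta> ?e" x] \<delta>(1) by (auto simp del: of_nat_Suc)
          have "infdist (f d) ?C \<le> dist (f d) (f x)" by (rule infdist_le[OF fx])
          also have "\<dots> < ?e" using \<delta>(2)[of d] d(2) by (simp add: dist_commute)
          finally show "?Q k" using d by auto
        qed
      next
        assume Q: "\<forall>k. ?Q k"
        then obtain d where d: "\<And>k. d k \<in> D" "\<And>k. dist x (d k) < inverse (real (Suc k))"
            "\<And>k. infdist (f (d k)) ?C < inverse (real (Suc k))"
          by metis
        have "d \<longlonglongrightarrow> x"
        proof (rule metric_tendsto_imp_tendsto[OF LIMSEQ_inverse_real_of_nat])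
          show "\<forall>\<^sub>F k in sequentially. dist (d k) x \<le> dist (inverse (real (Suc k))) 0"
            using d(2) by (intro always_eventually allI) (simp add: dist_commute less_imp_le del: of_nat_Suc)
        qed
        then have "(\<lambda>k. f (d k)) \<longlonglongrightarrow> f x"
          using continuous_on_tendsto_compose[of UNIV "apply_bcontfun f"] by auto
        then have "(\<lambda>k. infdist (f (d k)) ?C) \<longlonglongrightarrow> infdist (f x) ?C" by (rule tendsto_infdist)
        moreover have "(\<lambda>k. infdist (f (d k)) ?C) \<longlonglongrightarrow> 0"
        proof (rule metric_tendsto_imp_tendsto[OF LIMSEQ_inverse_real_of_nat])
          show "\<forall>\<^sub>F k in sequentially. dist (infdist (f (d k)) ?C) 0 \<le> dist (inverse (real (Suc k))) 0"
            using d(3) by (intro always_eventually allI)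
              (simp add: infdist_nonneg less_imp_le del: of_nat_Suc)
        qed
        ultimately have "infdist (f x) ?C = 0" by (rule LIMSEQ_unique)
        then show "f x \<in> ?C"
          using in_closed_iff_infdist_zero[of ?C "f x"] False \<open>open U\<close> by (simp add: closed_Compl)
      qed
      have [measurable]: "(\<lambda>f. infdist (apply_bcontfun f d) ?C) \<in> borel_measurable \<mu>" for d
      proof -
        have "continuous_on UNIV (\<lambda>f :: 'a \<Rightarrow>\<^sub>C 'a. apply_bcontfun f d)"
          unfolding continuous_on_iff by (meson dist_fun_lt_imp_dist_val_lt)
        then have "continuous_on UNIV (\<lambda>f :: 'a \<Rightarrow>\<^sub>C 'a. infdist (apply_bcontfun f d) ?C)"
          by (rule continuous_on_infdist)
        then show ?thesis
          using measurable_cong_sets[OF \<mu> refl]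
          by (metis borel_measurable_continuous_onI measurable_restrict_space1)
      qed
      have [measurable]: "(\<lambda>x. dist x d) \<in> borel_measurable \<nu>" for d
        unfolding measurable_cong_sets[OF \<nu> refl]
        by (intro borel_measurable_continuous_onI continuous_intros)
      have "{p \<in> space ?P. \<forall>k::nat. \<exists>d\<in>D. dist (snd p) d < inverse (real (Suc k)) \<and>
          infdist (apply_bcontfun (fst p) d) ?C < inverse (real (Suc k))} \<in> sets ?P"
        by (intro sets.sets_Collect_countable_All sets.sets_Collect_countable_Ex'[OF _ D(1)]) measurable
      then have "space ?P - {p \<in> space ?P. apply_bcontfun (fst p) (snd p) \<in> ?C} \<in> sets ?P"
        unfolding ev by auto
      moreover have "space ?P - {p \<in> space ?P. apply_bcontfun (fst p) (snd p) \<in> ?C} =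
          (\<lambda>p. apply_bcontfun (fst p) (snd p)) -` U \<inter> space ?P" by auto
      ultimately show ?thesis by simp
    qed
  qed
  then show ?thesis by (simp add: case_prod_beta')
qed

lemma conv_in_borel_prob:
  fixes \<mu> :: "('a::metric_space \<Rightarrow>\<^sub>C 'a) measure" and \<nu> :: "'a measure"
  assumes "compact (UNIV :: 'a set)" "\<mu> \<in> borel_prob Homeo" "\<nu> \<in> borel_prob UNIV"
  shows "conv \<mu> \<nu> \<in> borel_prob UNIV"
proof -
  interpret \<mu>: prob_space \<mu> using assms by (simp add: borel_prob_def)
  interpret \<nu>: prob_space \<nu> using assms by (simp add: borel_prob_def)
  interpret pair_prob_space \<mu> \<nu> ..
  show ?thesis
    using prob_space_distr[OF measurable_eval[OF assms]] by (simp add: borel_prob_def conv_def)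
qed

lemma topspace_weak_topology: "topspace (weak_topology S) = borel_prob S"
proof -
  have "borel_prob S \<in> {{M \<in> borel_prob S. (LINT x|M. \<phi> x) \<in> U} |\<phi> U.
        continuous_on S \<phi> \<and> bounded (\<phi> ` S) \<and> open (U :: real set)}"
    by (rule CollectI, rule exI[of _ "\<lambda>_. 0"], rule exI[of _ UNIV]) (auto simp: image_constant_conv)
  then show ?thesis by (auto simp: weak_topology_def)
qed

text \<open>\<open>conv_upto \<mu> \<nu> n\<close> is \<open>\<mu>\<^sub>n * \<dots> * \<mu>\<^sub>1 * \<nu>\<close>; the value \<open>\<mu> 0\<close> is never used.\<close>

primrec conv_upto ::
    "(nat \<Rightarrow> ('a::metric_space \<Rightarrow>\<^sub>C 'a) measure) \<Rightarrow> 'a measure \<Rightarrow> nat \<Rightarrow> 'a measure" where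
  "conv_upto \<mu> \<nu> 0 = \<nu>"
| "conv_upto \<mu> \<nu> (Suc n) = conv (\<mu> (Suc n)) (conv_upto \<mu> \<nu> n)"

definition deterministic_finite_image :: "('a::metric_space \<Rightarrow>\<^sub>C 'a) measure \<Rightarrow> bool" where
  "deterministic_finite_image \<mu> \<longleftrightarrow>
     (\<exists>F F'. finite F \<and> F \<noteq> {} \<and> finite F' \<and> F' \<noteq> {} \<and> (AE f in \<mu>. apply_bcontfun f ` F = F'))"

definition deterministic_measure_image :: "('a::metric_space \<Rightarrow>\<^sub>C 'a) measure \<Rightarrow> bool" where
  "deterministic_measure_image \<mu> \<longleftrightarrow>
     (\<exists>\<nu>\<in>borel_prob UNIV. \<exists>\<nu>'\<in>borel_prob UNIV. AE f in \<mu>. distr \<nu> borel (apply_bcontfun f) = \<nu>')"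

end

theory Submission
  imports Defs
begin

text \<open>
  Measure the concentration of a probability measure \<open>\<nu>\<close> by its atom energy
  \<open>Q(\<nu>) = \<Sum>\<^sub>x \<nu>{x}\<^sup>2\<close>. Since \<open>Max(\<nu>)\<^sup>2 \<le> Q(\<nu>) \<le> 1\<close>, both parts of the theorem reduce to showing
  that one convolution step multiplies \<open>Q\<close> by a factor bounded away from \<open>1\<close>.

  View the atoms of \<open>f\<^sub>*\<nu>\<close> as a vector \<open>u\<^sub>f\<close> in the Hilbert space of square summable functions
  on \<open>X\<close>. A homeomorphism only permutes atoms, so \<open>\<parallel>u\<^sub>f\<parallel>\<^sup>2 = Q(\<nu>)\<close> for every \<open>f\<close>, while the atoms
  of \<open>\<mu> * \<nu>\<close> form the mean vector \<open>w = \<integral> u\<^sub>f d\<mu>(f)\<close>. Hence the loss of energy is a variance,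
  \<open>Q(\<nu>) - Q(\<mu> * \<nu>) = \<integral> \<parallel>u\<^sub>f - w\<parallel>\<^sup>2 d\<mu>(f)\<close>. If the loss is relatively small, then \<open>u\<^sub>f\<close> is
  nearly independent of \<open>f\<close>, and so is the image under \<open>f\<close> of the probability measure
  \<open>\<rho>\<^sub>\<nu>\<close> with weights \<open>\<nu>{x}\<^sup>2 / Q(\<nu>)\<close>. Deviation from a deterministic image is measured by
  the \<open>discrepancy\<close>, a bounded Lipschitz distance between \<open>f\<^sub>*\<rho>\<close> and a target functional;
  \<open>atom_energy_contracts\<close> turns a lower bound on the mean discrepancy into a contraction of \<open>Q\<close>.

  It remains to bound the mean discrepancy from below, uniformly over \<open>\<mu> \<in> K\<close>. The discrepancies
  are \<open>1\<close>-Lipschitz functions of \<open>f\<close>, whatever \<open>\<rho>\<close> and the target are, and an Arzela-Ascoli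
  argument shows that a lower bound for the integrals of an equi-Lipschitz family persists in a weak
  neighbourhood of \<open>\<mu>\<close> (\<open>integral_lower_bound_locally_uniform\<close>). By compactness of \<open>K\<close> a single
  \<open>\<mu>\<close> can be treated at a time. If for this \<open>\<mu>\<close> there were \<open>\<rho>\<^sub>n\<close> whose mean discrepancy tends
  to \<open>0\<close>, a weak limit \<open>\<rho>\<close> of a subsequence would satisfy \<open>f\<^sub>*\<rho> = \<nu>'\<close> for \<open>\<mu>\<close>-almost every
  \<open>f\<close> (\<open>vanishing_discrepancy_limit\<close>). This is a measure with a deterministic image, which
  gives part (2): \<open>Q\<close> decays geometrically.

  For part (1) only measures with \<open>Max(\<nu>) \<ge> \<epsilon>\<close> are considered. Then \<open>\<rho>\<^sub>\<nu>\<close> has an atom of weight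
  at least \<open>\<epsilon>\<^sup>2\<close>, so the weak limit \<open>\<rho>\<close> has one too, and the finite nonempty set of maximal atoms
  of \<open>\<rho>\<close> has a deterministic image. Thus \<open>Q\<close> contracts as long as \<open>Max \<ge> \<epsilon>\<close>. As \<open>Max\<close> never
  increases, it must fall below \<open>\<epsilon>\<close> after a number of steps depending only on \<open>\<epsilon>\<close> and \<open>K\<close>.
\<close>

section \<open>Weak limits of discrete measures on compact metric spaces\<close>

text \<open>
  The point of the Cantor set with ternary digits \<open>2 b\<^sub>i\<close>. The gaps of the Cantor set make every
  digit a locally constant function of the point, which plain binary expansions do not.
\<close>

definition ternary :: "(nat \<Rightarrow> bool) \<Rightarrow> real" where
  "ternary b = (\<Sum>i. of_bool (b i) * (2 / 3) * (1 / 3) ^ i)"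

lemma summable_ternary: "summable (\<lambda>i. of_bool (b i) * (2 / 3) * (1 / 3 :: real) ^ i)"
  by (rule summable_comparison_test'[of "\<lambda>i. (2 / 3) * (1 / 3) ^ i" 0])
    (auto intro!: summable_mult summable_geometric)

lemma ternary_nonneg: "0 \<le> ternary b"
  unfolding ternary_def by (intro suminf_nonneg summable_ternary) auto

lemma ternary_le_one: "ternary b \<le> 1"
proof -
  have "ternary b \<le> (\<Sum>i. (2 / 3) * (1 / 3 :: real) ^ i)"
    unfolding ternary_def
    by (intro suminf_le summable_ternary summable_mult summable_geometric) auto
  also have "\<dots> = 1"
    using suminf_mult[OF summable_geometric[of "1 / 3 :: real"], of "2 / 3"]
    by (simp add: suminf_geometric)
  finally show ?thesis .
qed

lemma ternary_shift: "ternary b = of_bool (b 0) * 2 / 3 + ternary (\<lambda>i. b (Suc i)) / 3"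
proof -
  have "ternary b = (\<Sum>i. of_bool (b (Suc i)) * (2 / 3) * (1 / 3) ^ i * (1 / 3)) + of_bool (b 0) * 2 / 3"
    unfolding ternary_def using suminf_split_initial_segment[OF summable_ternary, of b 1]
    by (simp add: mult_ac)
  also have "(\<Sum>i. of_bool (b (Suc i)) * (2 / 3) * (1 / 3) ^ i * (1 / 3)) = ternary (\<lambda>i. b (Suc i)) * (1 / 3)"
    unfolding ternary_def by (rule suminf_mult2[OF summable_ternary, symmetric])
  finally show ?thesis by simp
qed

lemma ternary_close_imp_digit_eq:
  assumes "\<bar>ternary a - ternary b\<bar> < (1 / 3) ^ Suc j"
  shows "a j = b j"
  using assms
proof (induction j arbitrary: a b)
  case 0
  then show ?case
    using ternary_shift[of a] ternary_shift[of b] ternary_nonneg[of "\<lambda>i. a (Suc i)"]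
      ternary_nonneg[of "\<lambda>i. b (Suc i)"] ternary_le_one[of "\<lambda>i. a (Suc i)"]
      ternary_le_one[of "\<lambda>i. b (Suc i)"]
    by (cases "a 0"; cases "b 0") (auto simp: abs_if split: if_splits)
next
  case (Suc j)
  have "(1 / 3 :: real) ^ Suc (Suc j) \<le> 1 / 3"
    using power_decreasing[of 1 "Suc (Suc j)" "1 / 3 :: real"] by simp
  then have "\<bar>ternary a - ternary b\<bar> < 1 / 3" using Suc.prems by linarith
  then have "a 0 = b 0"
    using ternary_shift[of a] ternary_shift[of b] ternary_nonneg[of "\<lambda>i. a (Suc i)"]
      ternary_nonneg[of "\<lambda>i. b (Suc i)"] ternary_le_one[of "\<lambda>i. a (Suc i)"]
      ternary_le_one[of "\<lambda>i. b (Suc i)"]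
    by (cases "a 0"; cases "b 0") (auto simp: abs_if split: if_splits)
  then have "ternary (\<lambda>i. a (Suc i)) - ternary (\<lambda>i. b (Suc i)) = 3 * (ternary a - ternary b)"
    using ternary_shift[of a] ternary_shift[of b] by (simp add: field_simps)
  then have "\<bar>ternary (\<lambda>i. a (Suc i)) - ternary (\<lambda>i. b (Suc i))\<bar> < (1 / 3) ^ Suc j"
    using Suc.prems by (simp add: abs_mult del: right_diff_distrib_numeral)
  from Suc.IH[OF this] show ?case .
qed

text \<open>
  Compact metric spaces are continuous images \<open>h ` C\<close> of compact sets of reals; this transports
  Helly's selection theorem from the line to \<open>X\<close>. A point is coded by the digits recording which
  closed balls, with centres in a countable dense set and rational radii, contain it. The code \<open>s\<close>
  need not be continuous, but the closure of its graph is still the graph of a function of the code: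
  two distinct points are separated by a ball in such a way that points near the first lie in it and
  points near the second do not, so their codes stay apart by a fixed amount.
\<close>

lemma compact_metric_section_into_reals:
  assumes X: "compact (UNIV :: 'a::metric_space set)"
  obtains s :: "'a::metric_space \<Rightarrow> real" and C h where
    "compact C" "C \<subseteq> {0..1}" "continuous_on C h" "\<And>x. s x \<in> C" "\<And>x. h (s x) = x"
proof -
  obtain D :: "'a set" where D: "countable D" "\<And>x e. e > 0 \<Longrightarrow> \<exists>d\<in>D. dist x d < e"
    using countable_dense_compact[OF X] by blast
  define \<A> where "\<A> = (\<lambda>(d, q). {z. dist z d \<le> q}) ` (D \<times> \<rat>)"
  have \<A>: "countable \<A>" "\<A> \<noteq> {}"
    using D(1) D(2)[of 1] by (auto simp: \<A>_def intro!: countable_rat countable_SIGMA Rats_0)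
  define A where "A = from_nat_into \<A>"
  have A: "\<exists>j. A j = {z. dist z d \<le> q}" if "d \<in> D" "q \<in> \<rat>" for d q
    using from_nat_into_surj[OF \<A>(1)] that unfolding A_def \<A>_def by fast
  define s where "s x = ternary (\<lambda>j. x \<in> A j)" for x
  define Z where "Z = closure (range (\<lambda>x. (s x, x)))"
  have "compact ({0..1 :: real} \<times> (UNIV :: 'a set))" by (intro compact_Times X compact_Icc)
  moreover have Z_sub: "Z \<subseteq> {0..1} \<times> UNIV"
    unfolding Z_def
    by (intro closure_minimal compact_imp_closed[OF \<open>compact ({0..1} \<times> UNIV)\<close>])
      (auto simp: s_def ternary_nonneg ternary_le_one)
  ultimately have "compact Z"
    using compact_Int_closed[of "{0..1 :: real} \<times> (UNIV :: 'a set)" Z]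
    by (simp add: Z_def inf.absorb2)
  \<comment> \<open>a code determines the point\<close>
  have unique: "x = y" if "(t, x) \<in> Z" "(t, y) \<in> Z" for t x y
  proof (rule ccontr)
    assume "x \<noteq> y"
    define e where "e = dist x y / 3"
    have e: "e > 0" using \<open>x \<noteq> y\<close> by (simp add: e_def)
    obtain d where d: "d \<in> D" "dist x d < e" using D(2)[OF e] by blast
    have "dist x y \<le> dist x d + dist y d" by (rule dist_triangle2)
    then have "dist x d < dist y d" using d(2) e unfolding e_def by linarith
    then obtain q where q: "q \<in> \<rat>" "dist x d < q" "q < dist y d"
      using Rats_dense_in_real by blast
    obtain j where j: "A j = {z. dist z d \<le> q}" using A[OF d(1) q(1)] by blast
    obtain u where u: "\<And>n. u n \<in> range (\<lambda>x. (s x, x))" "u \<longlonglongrightarrow> (t, x)"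
      using \<open>(t, x) \<in> Z\<close> unfolding Z_def closure_sequential by blast
    obtain v where v: "\<And>n. v n \<in> range (\<lambda>x. (s x, x))" "v \<longlonglongrightarrow> (t, y)"
      using \<open>(t, y) \<in> Z\<close> unfolding Z_def closure_sequential by blast
    have u': "fst (u n) = s (snd (u n))" and v': "fst (v n) = s (snd (v n))" for n
      using u(1)[of n] v(1)[of n] by auto
    have "(\<lambda>n. dist (snd (u n)) d) \<longlonglongrightarrow> dist x d" "(\<lambda>n. dist (snd (v n)) d) \<longlonglongrightarrow> dist y d"
      using tendsto_snd[OF u(2)] tendsto_snd[OF v(2)] by (auto intro!: tendsto_dist tendsto_const)
    then have "\<forall>\<^sub>F n in sequentially. dist (snd (u n)) d < q"
        "\<forall>\<^sub>F n in sequentially. q < dist (snd (v n)) d"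
      using q by (auto intro: order_tendstoD)
    moreover have "(\<lambda>n. \<bar>fst (u n) - fst (v n)\<bar>) \<longlonglongrightarrow> \<bar>t - t\<bar>"
      using tendsto_fst[OF u(2)] tendsto_fst[OF v(2)] by (intro tendsto_intros) auto
    then have "\<forall>\<^sub>F n in sequentially. \<bar>fst (u n) - fst (v n)\<bar> < (1 / 3) ^ Suc j"
      by (rule order_tendstoD) auto
    ultimately have "\<forall>\<^sub>F n in sequentially. False"
    proof eventually_elim
      case (elim n)
      have "(snd (u n) \<in> A j) = (snd (v n) \<in> A j)"
        using ternary_close_imp_digit_eq elim(3) unfolding u' v' s_def by blast
      then show ?case using elim(1,2) j by auto
    qed
    then show False by simp
  qed
  define h where "h t = snd (THE z. z \<in> Z \<and> fst z = t)" for t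
  have h: "h (fst z) = snd z" if "z \<in> Z" for z
  proof -
    have "(THE z'. z' \<in> Z \<and> fst z' = fst z) = z"
      using that unique by (intro the_equality) (auto simp: prod_eq_iff)
    then show ?thesis by (simp add: h_def)
  qed
  have sZ: "(s x, x) \<in> Z" for x unfolding Z_def by (rule subsetD[OF closure_subset]) blast
  show thesis
  proof (rule that[of "fst ` Z" h s])
    show "compact (fst ` Z)"
      by (intro compact_continuous_image \<open>compact Z\<close> continuous_on_fst continuous_on_id)
    show "fst ` Z \<subseteq> {0..1}" using Z_sub by auto
    have "continuous_on (fst ` Z) (\<lambda>t. (t, h t))"
      using h by (intro continuous_on_inv \<open>compact Z\<close> continuous_on_fst continuous_on_id)
        (auto simp: prod_eq_iff)
    then show "continuous_on (fst ` Z) h" using continuous_on_snd by fastforce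
    show "s x \<in> fst ` Z" for x using sZ by force
    show "h (s x) = x" for x using h[OF sZ] by simp
  qed
qed

text \<open>
  Sequential weak compactness for discrete measures. These can be moved to the line by
  the section \<open>s\<close>, although it need not be continuous, because every function is measurable for a
  \<open>pmf\<close>; the limit is moved back by the continuous map \<open>h\<close>.
\<close>

lemma pmf_weakly_convergent_subsequence:
  fixes p :: "nat \<Rightarrow> 'a::metric_space pmf"
  assumes "compact (UNIV :: 'a set)"
  obtains r and \<rho> :: "'a measure" where "strict_mono r" "\<rho> \<in> borel_prob UNIV"
    "\<And>\<phi> :: 'a \<Rightarrow> real. continuous_on UNIV \<phi> \<Longrightarrow>
       (\<lambda>n. measure_pmf.expectation (p (r n)) \<phi>) \<longlonglongrightarrow> (LINT x|\<rho>. \<phi> x)"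
proof -
  obtain s :: "'a \<Rightarrow> real" and C h where C: "compact C" "C \<subseteq> {0..1}"
    and h: "continuous_on C h" "\<And>x. h (s x) = x" and s: "\<And>x. s x \<in> C"
    using compact_metric_section_into_reals[OF assms] by metis
  define m where "m n = distr (measure_pmf (p n)) borel s" for n
  have m: "real_distribution (m n)" for n
    unfolding m_def by (intro prob_space.real_distribution_distr prob_space_measure_pmf) simp
  have "tight m" unfolding tight_def
  proof (intro conjI allI impI)
    fix \<epsilon> :: real assume "\<epsilon> > 0"
    have "measure (m n) {- 1<..1} = 1" for n
    proof -
      have "s -` {- 1<..1} = UNIV" using s C(2) by (force simp: subset_iff)
      then show ?thesis by (simp add: m_def measure_distr)
    qed
    then show "\<exists>a b. a < b \<and> (\<forall>n. 1 - \<epsilon> < measure (m n) {a<..b})"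
      using \<open>\<epsilon> > 0\<close> by (intro exI[of _ "- 1"] exI[of _ 1]) simp
  qed (rule m)
  from tight_imp_convergent_subsubsequence[OF this strict_mono_id]
  obtain r M where r: "strict_mono (r :: nat \<Rightarrow> nat)" and M: "real_distribution M"
    and conv: "weak_conv_m (\<lambda>n. m (r n)) M"
    by (auto simp: comp_def)
  interpret M: real_distribution M by (rule M)
  have lim: "(\<lambda>n. measure_pmf.expectation (p (r n)) (\<lambda>x. g (s x))) \<longlonglongrightarrow> (LINT t|M. g t)"
    if "continuous_on UNIV g" "\<And>t. norm (g t) \<le> B" for g :: "real \<Rightarrow> real" and B
  proof -
    have "g \<in> borel_measurable borel" using that(1) by (rule borel_measurable_continuous_onI)
    then have "(LINT t|m (r n). g t) = measure_pmf.expectation (p (r n)) (\<lambda>x. g (s x))" for n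
      unfolding m_def by (intro integral_distr) auto
    moreover have "(\<lambda>n. LINT t|m (r n). g t) \<longlonglongrightarrow> (LINT t|M. g t)"
      using weak_conv_imp_integral_bdd_continuous_conv[of "\<lambda>n. m (r n)" M g B] m M conv that
      by (auto simp: continuous_on_eq_continuous_at)
    ultimately show ?thesis by simp
  qed
  have "closed C" "C \<noteq> {}" using C(1) s by (auto intro: compact_imp_closed)
  \<comment> \<open>the distance to \<open>C\<close> is a bounded continuous function that vanishes on all the images\<close>
  have AE_C: "AE t in M. t \<in> C"
  proof -
    let ?g = "\<lambda>t. min 1 (infdist t C)"
    have g: "continuous_on UNIV ?g" by (intro continuous_intros)
    have "(\<lambda>n. measure_pmf.expectation (p (r n)) (\<lambda>x. ?g (s x))) \<longlonglongrightarrow> (LINT t|M. ?g t)"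
      by (rule lim[OF g, of 1]) (auto simp: infdist_nonneg)
    then have "(LINT t|M. ?g t) = 0" using s by (simp add: LIMSEQ_const_iff)
    moreover have "integrable M ?g"
      using borel_measurable_continuous_onI[OF g]
      by (intro M.integrable_const_bound[of _ 1]) (auto simp: infdist_nonneg)
    ultimately have "AE t in M. ?g t = 0"
      by (subst (asm) integral_nonneg_eq_0_iff_AE) (auto simp: infdist_nonneg)
    then show ?thesis
      by eventually_elim (use in_closed_iff_infdist_zero[OF \<open>closed C\<close> \<open>C \<noteq> {}\<close>] in
          \<open>auto simp: min_def split: if_splits\<close>)
  qed
  define h' where "h' t = (if t \<in> C then h t else undefined)" for t
  have h': "h' \<in> borel_measurable borel"
    unfolding h'_def using \<open>closed C\<close> h(1) by (intro borel_measurable_continuous_on_if) auto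
  show thesis
  proof (rule that[OF r, of "distr M borel h'"])
    show "distr M borel h' \<in> borel_prob UNIV"
      using h' by (auto simp: borel_prob_def intro!: M.prob_space_distr)
    fix \<phi> :: "'a \<Rightarrow> real" assume \<phi>: "continuous_on UNIV \<phi>"
    have "continuous_on C (\<lambda>t. \<phi> (h t))"
      using continuous_on_compose2[OF \<phi> h(1)] by simp
    moreover have "bounded (range \<phi>)"
      using compact_continuous_image[OF \<phi> assms] by (rule compact_imp_bounded)
    then obtain B where "\<And>x. norm (\<phi> x) \<le> B" by (auto simp: bounded_iff)
    moreover from this have "0 \<le> B" by (meson norm_ge_zero order_trans)
    ultimately obtain g where g: "continuous_on UNIV g" "\<And>t. t \<in> C \<Longrightarrow> g t = \<phi> (h t)"
        "\<And>t. norm (g t) \<le> B"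
      using Tietze[of C "\<lambda>t. \<phi> (h t)" UNIV B] \<open>closed C\<close> by auto
    have [measurable]: "g \<in> borel_measurable borel" "\<phi> \<in> borel_measurable borel"
      using g(1) \<phi> by (auto intro: borel_measurable_continuous_onI)
    note h'[measurable]
    have "(LINT x|distr M borel h'. \<phi> x) = (LINT t|M. \<phi> (h' t))"
      by (intro integral_distr) auto
    also have "\<dots> = (LINT t|M. g t)"
    proof (rule integral_cong_AE)
      show "AE t in M. \<phi> (h' t) = g t" using AE_C by eventually_elim (simp add: h'_def g(2))
    qed measurable
    finally show "(\<lambda>n. measure_pmf.expectation (p (r n)) \<phi>) \<longlonglongrightarrow> (LINT x|distr M borel h'. \<phi> x)"
      using lim[OF g(1,3)] g(2)[OF s] h(2) by simp
  qed
qed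

section \<open>Uniform lower bounds for integrals over weakly compact sets\<close>

text \<open>
  Sets of maps with a common modulus of continuity at the single scale \<open>\<eta>\<close>. The inequality
  \<open>\<le> \<delta>\<close> is not strict so that these sets are closed, hence measurable.
\<close>

definition maps_with_modulus :: "real \<Rightarrow> real \<Rightarrow> ('a::metric_space \<Rightarrow>\<^sub>C 'a) set" where
  "maps_with_modulus \<eta> \<delta> =
     {f. \<forall>x y. dist x y < \<eta> \<longrightarrow> dist (apply_bcontfun f x) (apply_bcontfun f y) \<le> \<delta>}"

text \<open>
  The combinatorial core of the Arzela-Ascoli theorem: up to \<open>4 \<delta>\<close>, a map in the set is determined
  by the values, rounded to a finite \<open>\<delta>\<close>-net, that it takes on a finite \<open>\<eta>\<close>-net.
\<close>

lemma maps_with_modulus_finite_net: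
  fixes E :: "('a::metric_space \<Rightarrow>\<^sub>C 'a) set"
  assumes X: "compact (UNIV :: 'a set)" and "\<delta> > 0" "\<eta> > 0"
    and E: "E \<subseteq> maps_with_modulus \<eta> \<delta>"
  obtains N where "finite N" "N \<subseteq> E" "\<And>f. f \<in> E \<Longrightarrow> \<exists>g\<in>N. dist f g \<le> 4 * \<delta>"
proof -
  have net: "\<exists>D. finite D \<and> (\<forall>x::'a. \<exists>d\<in>D. dist x d < e)" if e: "e > 0" for e
  proof -
    obtain k where "finite k" "(UNIV :: 'a set) \<subseteq> (\<Union>x\<in>k. ball x e)"
      using X e unfolding compact_eq_totally_bounded by blast
    then show ?thesis by (intro exI[of _ k]) (auto simp: subset_iff dist_commute)
  qed
  obtain D where D: "finite D" "\<And>x::'a. \<exists>d\<in>D. dist x d < \<eta>"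
    using net[OF \<open>\<eta> > 0\<close>] by blast
  obtain D' where D': "finite D'" "\<And>x::'a. \<exists>d\<in>D'. dist x d < \<delta>"
    using net[OF \<open>\<delta> > 0\<close>] by blast
  obtain \<pi> where \<pi>: "\<And>x. \<pi> x \<in> D'" "\<And>x. dist x (\<pi> x) < \<delta>"
    using D'(2) by metis
  define code where "code f = restrict (\<lambda>d. \<pi> (apply_bcontfun f d)) D" for f :: "'a \<Rightarrow>\<^sub>C 'a"
  have "code ` E \<subseteq> PiE D (\<lambda>_. D')" using \<pi>(1) by (auto simp: code_def)
  then have "finite (code ` E)" using finite_PiE[OF D(1), of "\<lambda>_. D'"] D'(1) by (metis finite_subset)
  then obtain N where N: "N \<subseteq> E" "finite N" "code ` E = code ` N"
    using finite_subset_image[of "code ` E" code E] by blast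
  show thesis
  proof (rule that[OF N(2,1)])
    fix f assume f: "f \<in> E"
    then obtain g where g: "g \<in> N" "code g = code f" using N(3) by (metis imageE imageI)
    have "dist (f x) (g x) \<le> 4 * \<delta>" for x
    proof -
      obtain d where d: "d \<in> D" "dist x d < \<eta>" using D(2) by blast
      have "\<pi> (g d) = \<pi> (f d)" using fun_cong[OF g(2), of d] d(1) by (simp add: code_def)
      then have "dist (g d) (\<pi> (f d)) < \<delta>" using \<pi>(2)[of "g d"] by simp
      moreover have "dist (f x) (f d) \<le> \<delta>"
        using E f d(2) by (auto simp: maps_with_modulus_def)
      moreover have "dist (g d) (g x) \<le> \<delta>"
        using E g(1) N(1) d(2) by (auto simp: maps_with_modulus_def dist_commute)
      moreover have "dist (f d) (\<pi> (f d)) < \<delta>" by (rule \<pi>(2))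
      moreover have "dist (f x) (g x) \<le> dist (f x) (f d) + dist (f d) (g d) + dist (g d) (g x)"
        by (meson dist_triangle dist_triangle_le add_mono order_refl order_trans)
      moreover have "dist (f d) (g d) \<le> dist (f d) (\<pi> (f d)) + dist (g d) (\<pi> (f d))"
        by (rule dist_triangle2)
      ultimately show ?thesis by linarith
    qed
    then have "dist f g \<le> 4 * \<delta>" by (rule dist_bound)
    then show "\<exists>g\<in>N. dist f g \<le> 4 * \<delta>" using g(1) by blast
  qed
qed

text \<open>
  Each map is uniformly continuous, so the sets \<open>maps_with_modulus \<eta> \<delta>\<close> exhaust the whole space as
  \<open>\<eta>\<close> decreases to \<open>0\<close>. This replaces tightness of \<open>\<mu>\<close>.
\<close>

lemma borel_prob_almost_equicontinuous:
  fixes \<mu> :: "('a::metric_space \<Rightarrow>\<^sub>C 'a) measure"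
  assumes X: "compact (UNIV :: 'a set)" and \<mu>: "\<mu> \<in> borel_prob S" and "\<delta> > 0"
  obtains \<eta> where "\<eta> > 0"
    "maps_with_modulus \<eta> \<delta> \<inter> space \<mu> \<in> sets \<mu>"
    "measure \<mu> (maps_with_modulus \<eta> \<delta> \<inter> space \<mu>) > 1 - \<delta>"
proof -
  interpret prob_space \<mu> using \<mu> by (simp add: borel_prob_def)
  have sets: "sets \<mu> = sets (restrict_space borel S)" using \<mu> by (simp add: borel_prob_def)
  define E :: "nat \<Rightarrow> ('a \<Rightarrow>\<^sub>C 'a) set"
    where "E m = maps_with_modulus (inverse (real (Suc m))) \<delta>" for m
  have ev: "continuous_on UNIV (\<lambda>f :: 'a \<Rightarrow>\<^sub>C 'a. apply_bcontfun f d)" for d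
    unfolding continuous_on_iff by (meson dist_fun_lt_imp_dist_val_lt)
  have cl: "closed (E m)" for m
  proof -
    have "E m = (\<Inter>(x, y)\<in>{(x, y). dist x y < inverse (real (Suc m))}.
        {f. dist (apply_bcontfun f x) (apply_bcontfun f y) \<le> \<delta>})"
      by (auto simp: E_def maps_with_modulus_def)
    moreover have "closed {f :: 'a \<Rightarrow>\<^sub>C 'a. dist (apply_bcontfun f x) (apply_bcontfun f y) \<le> \<delta>}" for x y
      by (intro closed_Collect_le continuous_on_dist ev continuous_on_const)
    ultimately show ?thesis by (auto intro!: closed_INT)
  qed
  have E_sets: "E m \<inter> space \<mu> \<in> sets \<mu>" for m
  proof -
    have "space \<mu> = S" using sets_eq_imp_space_eq[OF sets] by (simp add: space_restrict_space)
    then have "E m \<inter> space \<mu> \<in> (\<inter>) S ` sets borel"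
      using borel_closed[OF cl, of m] by (simp add: Int_commute[of _ S])
    then show ?thesis by (subst sets) (simp only: sets_restrict_space)
  qed
  have "incseq (\<lambda>m. E m \<inter> space \<mu>)"
  proof (rule incseq_SucI)
    fix m
    have "inverse (real (Suc (Suc m))) \<le> inverse (real (Suc m))" by (simp add: field_simps)
    then show "E m \<inter> space \<mu> \<subseteq> E (Suc m) \<inter> space \<mu>"
      unfolding E_def maps_with_modulus_def using order.strict_trans2 by blast
  qed
  moreover have "(\<Union>m. E m \<inter> space \<mu>) = space \<mu>"
  proof -
    have "\<exists>m. f \<in> E m" for f
    proof -
      have "uniformly_continuous_on UNIV (apply_bcontfun f)"
        using X by (intro compact_uniformly_continuous) auto
      then obtain e where e: "e > 0" "\<And>x y. dist x y < e \<Longrightarrow> dist (f x) (f y) < \<delta>"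
        using \<open>\<delta> > 0\<close> unfolding uniformly_continuous_on_def by (metis UNIV_I)
      obtain m where "inverse (real (Suc m)) < e" using reals_Archimedean[OF e(1)] by blast
      then show ?thesis using e(2) by (auto simp: E_def maps_with_modulus_def intro!: exI[of _ m] less_imp_le)
    qed
    then show ?thesis by auto
  qed
  ultimately have "(\<lambda>m. measure \<mu> (E m \<inter> space \<mu>)) \<longlonglongrightarrow> measure \<mu> (space \<mu>)"
    using finite_Lim_measure_incseq[of "\<lambda>m. E m \<inter> space \<mu>"] E_sets by auto
  then have "\<forall>\<^sub>F m in sequentially. 1 - \<delta> < measure \<mu> (E m \<inter> space \<mu>)"
    using \<open>\<delta> > 0\<close> by (intro order_tendstoD) (auto simp: prob_space)
  then obtain m where m: "1 - \<delta> < measure \<mu> (E m \<inter> space \<mu>)"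
    by (auto dest: eventually_happens)
  show thesis
    by (rule that[of "inverse (real (Suc m))"]) (use m E_sets in \<open>auto simp: E_def simp del: of_nat_Suc\<close>)
qed

text \<open>
  The bound \<open>2\<close> is the largest possible value of \<open>\<bar>\<integral> \<phi> d\<rho> - a\<bar>\<close> for \<open>\<bar>\<phi>\<bar> \<le> 1\<close> and \<open>\<bar>a\<bar> \<le> 1\<close>.
\<close>

definition bounded_nonexpansive :: "('b::metric_space \<Rightarrow> real) set" where
  "bounded_nonexpansive = {h. (\<forall>f g. \<bar>h f - h g\<bar> \<le> dist f g) \<and> (\<forall>f. 0 \<le> h f \<and> h f \<le> 2)}"

lemma nonexpansive_continuous_on:
  fixes h :: "'b::metric_space \<Rightarrow> real"
  assumes "\<And>x y. \<bar>h x - h y\<bar> \<le> dist x y"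
  shows "continuous_on S h"
  by (rule lipschitz_on_continuous_on[of 1]) (use assms in \<open>auto intro!: lipschitz_onI simp: dist_real_def\<close>)

lemma bounded_nonexpansive_continuous: "h \<in> bounded_nonexpansive \<Longrightarrow> continuous_on S h"
  by (intro nonexpansive_continuous_on) (simp add: bounded_nonexpansive_def)

lemma bounded_nonexpansive_integrable:
  assumes "h \<in> bounded_nonexpansive" "\<mu> \<in> borel_prob S"
  shows "integrable \<mu> h"
proof -
  interpret prob_space \<mu> using assms by (simp add: borel_prob_def)
  have "sets \<mu> = sets (restrict_space borel S)" using assms by (simp add: borel_prob_def)
  then have "h \<in> borel_measurable \<mu>"
    using borel_measurable_continuous_on_restrict[OF bounded_nonexpansive_continuous[OF assms(1)]]
      measurable_cong_sets by blast
  then show ?thesis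
    using assms(1) by (intro integrable_const_bound[of _ 2]) (auto simp: bounded_nonexpansive_def)
qed

lemma INF_bounded_nonexpansive:
  assumes "A \<noteq> {}" "A \<subseteq> bounded_nonexpansive"
  shows "(\<lambda>f. INF h\<in>A. h f) \<in> bounded_nonexpansive"
proof -
  have bd: "bdd_below ((\<lambda>h. h f) ` A)" for f
    using assms(2) by (auto simp: bounded_nonexpansive_def bdd_below_def intro!: exI[of _ 0])
  have le: "(INF h\<in>A. h f) \<le> (INF h\<in>A. h g) + dist f g" for f g
  proof -
    have "(INF h\<in>A. h f) - dist f g \<le> h g" if "h \<in> A" for h
    proof -
      have "(INF h\<in>A. h f) \<le> h f" using that by (rule cINF_lower[OF bd])
      moreover have "\<bar>h f - h g\<bar> \<le> dist f g" using that assms(2) by (auto simp: bounded_nonexpansive_def)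
      ultimately show ?thesis by linarith
    qed
    then have "(INF h\<in>A. h f) - dist f g \<le> (INF h\<in>A. h g)" using assms(1) by (intro cINF_greatest)
    then show ?thesis by simp
  qed
  obtain h where h: "h \<in> A" using assms(1) by blast
  have "(INF h\<in>A. h f) \<le> 2" for f
    using cINF_lower[OF bd h, of f] subsetD[OF assms(2) h] by (auto simp: bounded_nonexpansive_def intro: order_trans)
  moreover have "0 \<le> (INF h\<in>A. h f)" for f
    using assms by (intro cINF_greatest) (auto simp: bounded_nonexpansive_def)
  ultimately show ?thesis
    using le by (auto simp: bounded_nonexpansive_def abs_le_iff) (metis add.commute diff_le_eq dist_commute)+
qed

text \<open>
  Weak convergence is uniform over equi-Lipschitz families. Up to a set of maps of \<open>\<mu>\<close>-measure
  less than \<open>\<delta>\<close>, the members of \<open>H\<close> are determined within \<open>9 \<delta>\<close> by their rounded values on a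
  finite set of maps. So \<open>H\<close> splits into finitely many classes, and the pointwise infimum \<open>\<psi>\<close> of a
  class is again Lipschitz and nearly as large as each member. Finitely many open conditions on the
  integrals of the functions \<open>\<psi>\<close> then control all of \<open>H\<close>.
\<close>

lemma integral_lower_bound_locally_uniform:
  fixes \<mu> :: "('a::metric_space \<Rightarrow>\<^sub>C 'a) measure"
  assumes X: "compact (UNIV :: 'a set)" and \<mu>: "\<mu> \<in> borel_prob S"
    and H: "H \<subseteq> bounded_nonexpansive" and c: "c > 0" "\<And>h. h \<in> H \<Longrightarrow> c \<le> (LINT f|\<mu>. h f)"
  obtains U where "openin (weak_topology S) U" "\<mu> \<in> U"
    "\<And>\<mu>' h. \<mu>' \<in> U \<Longrightarrow> h \<in> H \<Longrightarrow> c / 2 < (LINT f|\<mu>'. h f)"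
proof -
  interpret prob_space \<mu> using \<mu> by (simp add: borel_prob_def)
  \<comment> \<open>the total loss is \<open>9 \<delta> + 2 \<delta> < c / 2\<close>\<close>
  define \<delta> where "\<delta> = c / 24"
  have "\<delta> > 0" using c by (simp add: \<delta>_def)
  obtain \<eta> where \<eta>: "\<eta> > 0"
    and E: "maps_with_modulus \<eta> \<delta> \<inter> space \<mu> \<in> sets \<mu>"
    and mE: "measure \<mu> (maps_with_modulus \<eta> \<delta> \<inter> space \<mu>) > 1 - \<delta>"
    by (rule borel_prob_almost_equicontinuous[OF X \<mu> \<open>\<delta> > 0\<close>])
  let ?E = "maps_with_modulus \<eta> \<delta> \<inter> space \<mu>"
  obtain N where N: "finite N" "\<And>f. f \<in> ?E \<Longrightarrow> \<exists>g\<in>N. dist f g \<le> 4 * \<delta>"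
    using maps_with_modulus_finite_net[OF X \<open>\<delta> > 0\<close> \<eta> Int_lower1] by metis
  define code :: "(('a \<Rightarrow>\<^sub>C 'a) \<Rightarrow> real) \<Rightarrow> ('a \<Rightarrow>\<^sub>C 'a) \<Rightarrow> int"
    where "code h = restrict (\<lambda>g. \<lfloor>h g / \<delta>\<rfloor>) N" for h
  have "code ` H \<subseteq> PiE N (\<lambda>_. {0..\<lfloor>2 / \<delta>\<rfloor>})"
  proof
    fix v assume "v \<in> code ` H"
    then obtain h where h: "h \<in> H" "v = code h" by blast
    have "0 \<le> h g / \<delta>" "h g / \<delta> \<le> 2 / \<delta>" for g
      using h(1) H \<open>\<delta> > 0\<close> by (auto simp: bounded_nonexpansive_def intro!: divide_right_mono)
    then have "\<lfloor>h g / \<delta>\<rfloor> \<in> {0..\<lfloor>2 / \<delta>\<rfloor>}" for g by (simp add: floor_mono)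
    then show "v \<in> PiE N (\<lambda>_. {0..\<lfloor>2 / \<delta>\<rfloor>})" by (simp add: h(2) code_def)
  qed
  then have fin: "finite (code ` H)"
    using finite_PiE[OF N(1), of "\<lambda>_. {0..\<lfloor>2 / \<delta>\<rfloor>}"] by (metis finite_subset finite_atLeastAtMost_int)
  define \<psi> where "\<psi> v f = (INF h\<in>{h \<in> H. code h = v}. h f)" for v f
  have \<psi>: "\<psi> v \<in> bounded_nonexpansive" if "v \<in> code ` H" for v
    unfolding \<psi>_def using that H by (intro INF_bounded_nonexpansive) auto
  have \<psi>_le: "\<psi> (code h) f \<le> h f" if "h \<in> H" for h f
    unfolding \<psi>_def using that H
    by (intro cINF_lower) (auto simp: bounded_nonexpansive_def bdd_below_def intro!: exI[of _ 0])
  have \<psi>_ge: "h0 f - 9 * \<delta> \<le> \<psi> (code h0) f" if h0: "h0 \<in> H" and f: "f \<in> ?E" for h0 f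
    unfolding \<psi>_def
  proof (rule cINF_greatest)
    show "{h \<in> H. code h = code h0} \<noteq> {}" using h0 by blast
    fix h assume "h \<in> {h \<in> H. code h = code h0}"
    then have h: "h \<in> H" "code h = code h0" by auto
    obtain g where g: "g \<in> N" "dist f g \<le> 4 * \<delta>" using N(2)[OF f] by blast
    have "\<lfloor>h g / \<delta>\<rfloor> = \<lfloor>h0 g / \<delta>\<rfloor>" using fun_cong[OF h(2), of g] g(1) by (simp add: code_def)
    then have "h0 g / \<delta> - h g / \<delta> \<le> 1" by linarith
    then have "h0 g - h g \<le> \<delta>" using \<open>\<delta> > 0\<close> by (simp add: field_simps)
    moreover have "\<bar>h f - h g\<bar> \<le> dist f g" "\<bar>h0 f - h0 g\<bar> \<le> dist f g"
      using h(1) h0 H by (auto simp: bounded_nonexpansive_def)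
    ultimately show "h0 f - 9 * \<delta> \<le> h f" using g(2) by linarith
  qed
  have int_\<psi>: "c / 2 < (LINT f|\<mu>. \<psi> v f)" if v: "v \<in> code ` H" for v
  proof -
    obtain h where h: "h \<in> H" "v = code h" using v by blast
    define D where "D = space \<mu> - ?E"
    have D: "D \<in> sets \<mu>" "measure \<mu> D < \<delta>"
      using E mE unfolding D_def by (auto simp: prob_compl[OF E])
    have int: "integrable \<mu> (\<psi> v)" "integrable \<mu> (indicator D :: _ \<Rightarrow> real)"
      using bounded_nonexpansive_integrable[OF \<psi>[OF v] \<mu>] D(1) by (auto simp: emeasure_eq_measure)
    have "(LINT f|\<mu>. h f) \<le> (LINT f|\<mu>. \<psi> v f + 9 * \<delta> + 2 * indicator D f)"
    proof (rule integral_mono)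
      show "integrable \<mu> h" using bounded_nonexpansive_integrable[OF _ \<mu>] h(1) H by blast
      show "integrable \<mu> (\<lambda>f. \<psi> v f + 9 * \<delta> + 2 * indicator D f)"
        using int by simp
      fix f assume f: "f \<in> space \<mu>"
      show "h f \<le> \<psi> v f + 9 * \<delta> + 2 * indicator D f"
      proof (cases "f \<in> ?E")
        case True
        then show ?thesis using \<psi>_ge[OF h(1) True] h(2) by (simp add: D_def)
      next
        case False
        moreover have "h f \<le> 2" "0 \<le> \<psi> v f" using h(1) H \<psi>[OF v] by (auto simp: bounded_nonexpansive_def)
        moreover have "indicator D f = (1 :: real)" using f False by (simp add: D_def)
        ultimately show ?thesis using \<open>\<delta> > 0\<close> by linarith
      qed
    qed
    also have "\<dots> = (LINT f|\<mu>. \<psi> v f) + 9 * \<delta> + 2 * measure \<mu> D"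
      using int D(1) by (simp add: prob_space)
    also have "measure \<mu> D < \<delta>" by (rule D(2))
    finally show ?thesis using c(1) c(2)[OF h(1)] by (simp add: \<delta>_def)
  qed
  define V where "V v = {M \<in> borel_prob S. (LINT f|M. \<psi> v f) \<in> {c / 2<..}}" for v
  have V: "openin (weak_topology S) (V v)" if "v \<in> code ` H" for v
  proof -
    have "bounded (\<psi> v ` S)" using \<psi>[OF that] by (auto simp: bounded_nonexpansive_def bounded_iff intro!: exI[of _ 2])
    then show ?thesis
      unfolding weak_topology_def V_def using bounded_nonexpansive_continuous[OF \<psi>[OF that], of S]
      by (intro topology_generated_by_Basis CollectI exI[of _ "\<psi> v"] exI[of _ "{c / 2<..}"]) simp
  qed
  show thesis
  proof (rule that[of "topspace (weak_topology S) \<inter> (\<Inter>v\<in>code ` H. V v)"])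
    show "openin (weak_topology S) (topspace (weak_topology S) \<inter> (\<Inter>v\<in>code ` H. V v))"
      by (subst Int_commute) (intro openin_INT fin V)
    show "\<mu> \<in> topspace (weak_topology S) \<inter> (\<Inter>v\<in>code ` H. V v)"
      using \<mu> int_\<psi> by (auto simp: topspace_weak_topology V_def)
    fix \<mu>' h assume \<mu>': "\<mu>' \<in> topspace (weak_topology S) \<inter> (\<Inter>v\<in>code ` H. V v)" and h: "h \<in> H"
    then have *: "\<mu>' \<in> borel_prob S" "c / 2 < (LINT f|\<mu>'. \<psi> (code h) f)"
      by (auto simp: topspace_weak_topology V_def)
    have "(LINT f|\<mu>'. \<psi> (code h) f) \<le> (LINT f|\<mu>'. h f)"
      using h H \<psi> \<psi>_le *(1) by (intro integral_mono bounded_nonexpansive_integrable) auto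
    then show "c / 2 < (LINT f|\<mu>'. h f)" using *(2) by linarith
  qed
qed

lemma integral_lower_bound_uniform_on_compact:
  fixes K :: "('a::metric_space \<Rightarrow>\<^sub>C 'a) measure set"
  assumes X: "compact (UNIV :: 'a set)" and K: "compactin (weak_topology S) K"
    and H: "H \<subseteq> bounded_nonexpansive"
    and pos: "\<And>\<mu>. \<mu> \<in> K \<Longrightarrow> \<exists>c>0. \<forall>h\<in>H. c \<le> (LINT f|\<mu>. h f)"
  obtains c where "c > 0" "\<And>\<mu> h. \<mu> \<in> K \<Longrightarrow> h \<in> H \<Longrightarrow> c \<le> (LINT f|\<mu>. h f)"
proof -
  let ?good = "\<lambda>U c. openin (weak_topology S) U \<and> c > 0 \<and> (\<forall>\<mu>\<in>U. \<forall>h\<in>H. c \<le> (LINT f|\<mu>. h f))"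
  have K_sub: "K \<subseteq> borel_prob S"
    using compactin_subset_topspace[OF K] by (simp add: topspace_weak_topology)
  have loc: "\<exists>U c. ?good U c \<and> \<mu> \<in> U" if \<mu>: "\<mu> \<in> K" for \<mu>
  proof -
    obtain c where c: "c > 0" "\<And>h. h \<in> H \<Longrightarrow> c \<le> (LINT f|\<mu>. h f)" using pos[OF \<mu>] by blast
    from c obtain U where "openin (weak_topology S) U" "\<mu> \<in> U"
      "\<And>\<mu>' h. \<mu>' \<in> U \<Longrightarrow> h \<in> H \<Longrightarrow> c / 2 < (LINT f|\<mu>'. h f)"
      using integral_lower_bound_locally_uniform[OF X subsetD[OF K_sub \<mu>] H, of c] by blast
    then show ?thesis using c(1) by (intro exI[of _ U] exI[of _ "c / 2"]) (auto intro: less_imp_le)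
  qed
  have "\<exists>F. finite F \<and> F \<subseteq> {U. \<exists>c. ?good U c} \<and> K \<subseteq> \<Union>F"
  proof (rule compactinD[OF K])
    show "K \<subseteq> \<Union> {U. \<exists>c. ?good U c}"
    proof
      fix \<mu> assume "\<mu> \<in> K"
      from loc[OF this] obtain U c where "?good U c" "\<mu> \<in> U" by metis
      then show "\<mu> \<in> \<Union> {U. \<exists>c. ?good U c}" by (intro UnionI[of U] CollectI exI[of _ c])
    qed
  qed (elim CollectE exE conjE)
  then obtain F where F: "finite F" "F \<subseteq> {U. \<exists>c. ?good U c}" "K \<subseteq> \<Union>F" by blast
  have "\<exists>c. ?good U c" if "U \<in> F" for U using subsetD[OF F(2) that] by (rule CollectD)
  then have C: "?good U (SOME c. ?good U c)" if "U \<in> F" for U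
    using that by (intro someI_ex[of "?good U"])
  define C where "C U = (SOME c. ?good U c)" for U
  note C = C[folded C_def]
  define c where "c = Min (insert 1 (C ` F))"
  have "c > 0" using F(1) C by (auto simp: c_def)
  moreover have "c \<le> (LINT f|\<mu>. h f)" if in_K: "\<mu> \<in> K" "h \<in> H" for \<mu> h
  proof -
    obtain U where U: "U \<in> F" "\<mu> \<in> U" using F(3) in_K(1) by blast
    have "c \<le> C U" using F(1) U(1) by (auto simp: c_def)
    also have "C U \<le> (LINT f|\<mu>. h f)" using C[OF U(1)] U(2) in_K(2) by blast
    finally show ?thesis .
  qed
  ultimately show thesis using that by blast
qed

section \<open>Discrepancy from a deterministic image\<close>

lemma summable_on_dominated:
  fixes f g :: "'b \<Rightarrow> real"
  assumes "g summable_on A" "\<And>x. x \<in> A \<Longrightarrow> \<bar>f x\<bar> \<le> g x"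
  shows "f summable_on A"
  using Infinite_Sum.abs_summable_on_comparison_test'[of g A f] assms
  by (simp add: summable_on_iff_abs_summable_on_real[of f])

lemma has_sum_subtract:
  fixes f g :: "'b \<Rightarrow> real"
  assumes "(f has_sum a) A" "(g has_sum b) A"
  shows "((\<lambda>x. f x - g x) has_sum (a - b)) A"
  using has_sum_add[OF assms(1), of "\<lambda>x. - g x" "- b"] assms(2) by (simp add: has_sum_uminus)

lemma summable_pmf: "pmf p summable_on A"
  using pmf_abs_summable[of p A] by (simp add: abs_summable_equivalent[symmetric])

lemma pmf_expectation_eq_infsum:
  fixes g :: "'b \<Rightarrow> real"
  assumes "\<And>x. \<bar>g x\<bar> \<le> B"
  shows "measure_pmf.expectation p g = (\<Sum>\<^sub>\<infinity>x. pmf p x * g x)"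
proof -
  have sum: "(\<lambda>x. norm (pmf p x * g x)) summable_on UNIV"
    using assms by (intro Infinite_Sum.abs_summable_on_comparison_test'[where g = "\<lambda>x. pmf p x * B"]
        summable_on_cmult_left summable_pmf) (auto simp: abs_mult mult_left_mono)
  show ?thesis
    unfolding pmf_expectation_eq_infsetsum
    by (rule infsetsum_infsum[OF iffD1[OF abs_summable_equivalent sum]])
qed

definition bounded_lipschitz_tests :: "('a::metric_space \<Rightarrow> real) set" where
  "bounded_lipschitz_tests = {\<phi>. (\<forall>x y. \<bar>\<phi> x - \<phi> y\<bar> \<le> dist x y) \<and> (\<forall>x. \<bar>\<phi> x\<bar> \<le> 1)}"

lemma bounded_lipschitz_tests_continuous: "\<phi> \<in> bounded_lipschitz_tests \<Longrightarrow> continuous_on S \<phi>"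
  by (intro nonexpansive_continuous_on) (simp add: bounded_lipschitz_tests_def)

text \<open>
  The dual bounded Lipschitz distance between \<open>f\<^sub>*\<rho>\<close> and a target. The target is an arbitrary
  bounded function \<open>\<alpha>\<close> of the test function; that it is given by a measure emerges only in the
  limit of vanishing discrepancy.
\<close>

definition discrepancy ::
    "'a pmf \<Rightarrow> (('a \<Rightarrow> real) \<Rightarrow> real) \<Rightarrow> ('a::metric_space \<Rightarrow>\<^sub>C 'a) \<Rightarrow> real" where
  "discrepancy \<rho> \<alpha> f =
     (SUP \<phi>\<in>bounded_lipschitz_tests. \<bar>measure_pmf.expectation \<rho> (\<lambda>x. \<phi> (apply_bcontfun f x)) - \<alpha> \<phi>\<bar>)"

lemma pmf_expectation_bound:
  fixes g :: "'b \<Rightarrow> real"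
  assumes "\<And>x. \<bar>g x\<bar> \<le> B"
  shows "\<bar>measure_pmf.expectation p g\<bar> \<le> B"
proof -
  have "integrable (measure_pmf p) g"
    using assms by (intro measure_pmf.integrable_const_bound[of _ B]) auto
  moreover have "- B \<le> g x" "g x \<le> B" for x using assms[of x] by auto
  ultimately show ?thesis
    using measure_pmf.integral_ge_const[of p g "- B"] measure_pmf.integral_le_const[of p g B] by auto
qed

lemma bdd_above_discrepancy:
  assumes "\<And>\<phi>. \<bar>\<alpha> \<phi>\<bar> \<le> 1"
  shows "\<phi> \<in> bounded_lipschitz_tests \<Longrightarrow>
      \<bar>measure_pmf.expectation \<rho> (\<lambda>x. \<phi> (apply_bcontfun f x)) - \<alpha> \<phi>\<bar> \<le> 2"
    and "bdd_above ((\<lambda>\<phi>. \<bar>measure_pmf.expectation \<rho> (\<lambda>x. \<phi> (apply_bcontfun f x)) - \<alpha> \<phi>\<bar>) ` bounded_lipschitz_tests)"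
proof -
  show *: "\<bar>measure_pmf.expectation \<rho> (\<lambda>x. \<phi> (apply_bcontfun f x)) - \<alpha> \<phi>\<bar> \<le> 2" if "\<phi> \<in> bounded_lipschitz_tests" for \<phi>
  proof -
    have "\<bar>measure_pmf.expectation \<rho> (\<lambda>x. \<phi> (apply_bcontfun f x))\<bar> \<le> 1"
      using that by (intro pmf_expectation_bound) (auto simp: bounded_lipschitz_tests_def)
    then show ?thesis using assms[of \<phi>] by linarith
  qed
  then show "bdd_above ((\<lambda>\<phi>. \<bar>measure_pmf.expectation \<rho> (\<lambda>x. \<phi> (apply_bcontfun f x)) - \<alpha> \<phi>\<bar>) ` bounded_lipschitz_tests)"
    by (auto intro!: bdd_aboveI2)
qed

lemma bounded_lipschitz_tests_nonempty: "bounded_lipschitz_tests \<noteq> {}"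
proof -
  have "(\<lambda>_. 0) \<in> bounded_lipschitz_tests" by (simp add: bounded_lipschitz_tests_def)
  then show ?thesis by blast
qed

lemma pmf_expectation_compose_lipschitz:
  assumes \<phi>: "\<phi> \<in> bounded_lipschitz_tests"
  shows "\<bar>measure_pmf.expectation \<rho> (\<lambda>x. \<phi> (apply_bcontfun f x)) -
      measure_pmf.expectation \<rho> (\<lambda>x. \<phi> (apply_bcontfun g x))\<bar> \<le> dist f g"
proof -
  have int: "integrable (measure_pmf \<rho>) (\<lambda>x. \<phi> (apply_bcontfun f x))" for f
    using \<phi> by (intro measure_pmf.integrable_const_bound[of _ 1]) (auto simp: bounded_lipschitz_tests_def)
  have "\<bar>measure_pmf.expectation \<rho> (\<lambda>x. \<phi> (apply_bcontfun f x) - \<phi> (apply_bcontfun g x))\<bar> \<le> dist f g"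
  proof (rule pmf_expectation_bound)
    fix x
    have "\<bar>\<phi> (apply_bcontfun f x) - \<phi> (apply_bcontfun g x)\<bar> \<le> dist (apply_bcontfun f x) (apply_bcontfun g x)"
      using \<phi> by (simp add: bounded_lipschitz_tests_def)
    also have "\<dots> \<le> dist f g" by (rule dist_bounded)
    finally show "\<bar>\<phi> (apply_bcontfun f x) - \<phi> (apply_bcontfun g x)\<bar> \<le> dist f g" .
  qed
  then show ?thesis using int by simp
qed

text \<open>
  The Lipschitz constant does not depend on \<open>\<rho>\<close> and \<open>\<alpha>\<close>: moving \<open>f\<close> by a distance \<open>d\<close> in the
  uniform metric moves every point \<open>f x\<close> by at most \<open>d\<close>.
\<close>

lemma discrepancy_bounded_nonexpansive:
  assumes \<alpha>: "\<And>\<phi>. \<bar>\<alpha> \<phi>\<bar> \<le> 1"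
  shows "discrepancy \<rho> \<alpha> \<in> bounded_nonexpansive"
proof -
  let ?E = "\<lambda>\<phi> f. measure_pmf.expectation \<rho> (\<lambda>x. \<phi> (apply_bcontfun f x))"
  note bdd = bdd_above_discrepancy[OF \<alpha>]
  have le: "discrepancy \<rho> \<alpha> f \<le> discrepancy \<rho> \<alpha> g + dist f g" for f g
    unfolding discrepancy_def
  proof (rule cSUP_least[OF bounded_lipschitz_tests_nonempty])
    fix \<phi> :: "'a \<Rightarrow> real" assume \<phi>: "\<phi> \<in> bounded_lipschitz_tests"
    have "\<bar>?E \<phi> f - \<alpha> \<phi>\<bar> \<le> \<bar>?E \<phi> g - \<alpha> \<phi>\<bar> + dist f g"
      using pmf_expectation_compose_lipschitz[OF \<phi>, of \<rho> f g] by linarith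
    also have "\<bar>?E \<phi> g - \<alpha> \<phi>\<bar> \<le> (SUP \<phi>\<in>bounded_lipschitz_tests. \<bar>?E \<phi> g - \<alpha> \<phi>\<bar>)"
      by (rule cSUP_upper[OF \<phi> bdd(2)])
    finally show "\<bar>?E \<phi> f - \<alpha> \<phi>\<bar> \<le> (SUP \<phi>\<in>bounded_lipschitz_tests. \<bar>?E \<phi> g - \<alpha> \<phi>\<bar>) + dist f g" by simp
  qed
  have "\<bar>discrepancy \<rho> \<alpha> f - discrepancy \<rho> \<alpha> g\<bar> \<le> dist f g" for f g
    using le[of f g] le[of g f] by (simp add: dist_commute abs_le_iff)
  moreover have "discrepancy \<rho> \<alpha> f \<le> 2" for f
    unfolding discrepancy_def by (intro cSUP_least bounded_lipschitz_tests_nonempty bdd(1))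
  moreover have "0 \<le> discrepancy \<rho> \<alpha> f" for f
  proof -
    have "(\<lambda>_. 0) \<in> (bounded_lipschitz_tests :: ('a \<Rightarrow> real) set)" by (simp add: bounded_lipschitz_tests_def)
    from cSUP_upper[OF this bdd(2)[where \<rho> = \<rho> and f = f]] show ?thesis
      unfolding discrepancy_def by (meson abs_ge_zero order_trans)
  qed
  ultimately show ?thesis by (auto simp: bounded_nonexpansive_def)
qed

section \<open>Loss of atom energy under convolution\<close>

definition atom_energy :: "'a measure \<Rightarrow> real" where
  "atom_energy \<nu> = (\<Sum>\<^sub>\<infinity>x. (measure \<nu> {x})\<^sup>2)"

text \<open>
  The measure \<open>\<rho>\<^sub>\<nu>\<close> of the introduction, meaningful only if \<open>\<nu>\<close> has an atom.
\<close>

definition atom_energy_pmf :: "'a measure \<Rightarrow> 'a pmf" where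
  "atom_energy_pmf \<nu> = embed_pmf (\<lambda>x. (measure \<nu> {x})\<^sup>2 / atom_energy \<nu>)"

context
  fixes \<nu> :: "'a::metric_space measure"
  assumes \<nu>: "\<nu> \<in> borel_prob UNIV"
begin

interpretation prob_space \<nu> using \<nu> by (simp add: borel_prob_def)

lemma sets_borel_prob: "sets \<nu> = sets borel"
  using \<nu> by (simp add: borel_prob_def)

lemma atoms_sum_le_one: "finite F \<Longrightarrow> (\<Sum>x\<in>F. measure \<nu> {x}) \<le> 1"
  using finite_measure_eq_sum_singleton[of F] prob_le_1[of F] by (simp add: sets_borel_prob)

lemma summable_atoms: "(\<lambda>x. measure \<nu> {x}) summable_on UNIV"
  by (intro nonneg_bdd_above_summable_on bdd_aboveI2[of _ _ 1] atoms_sum_le_one) auto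

lemma atom_square_le: "(measure \<nu> {x})\<^sup>2 \<le> measure \<nu> {x}"
  using mult_left_mono[OF prob_le_1[of "{x}"], of "measure \<nu> {x}"] by (simp add: power2_eq_square)

lemma summable_atom_squares: "(\<lambda>x. (measure \<nu> {x})\<^sup>2) summable_on UNIV"
  by (rule summable_on_dominated[OF summable_atoms]) (simp add: atom_square_le)

lemma atom_energy_le_one: "atom_energy \<nu> \<le> 1"
  unfolding atom_energy_def
proof (rule infsum_le_finite_sums[OF summable_atom_squares])
  fix F :: "'a set" assume "finite F"
  have "(\<Sum>x\<in>F. (measure \<nu> {x})\<^sup>2) \<le> (\<Sum>x\<in>F. measure \<nu> {x})" by (intro sum_mono atom_square_le)
  then show "(\<Sum>x\<in>F. (measure \<nu> {x})\<^sup>2) \<le> 1" using atoms_sum_le_one[OF \<open>finite F\<close>] by linarith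
qed

lemma atom_square_le_energy: "(measure \<nu> {x})\<^sup>2 \<le> atom_energy \<nu>"
  unfolding atom_energy_def using finite_sum_le_infsum[OF summable_atom_squares, of "{x}"] by simp

lemma atom_energy_nonneg: "0 \<le> atom_energy \<nu>"
  unfolding atom_energy_def by (intro infsum_nonneg) simp

lemma pmf_atom_energy_pmf:
  assumes "atom_energy \<nu> > 0"
  shows "pmf (atom_energy_pmf \<nu>) x = (measure \<nu> {x})\<^sup>2 / atom_energy \<nu>"
  unfolding atom_energy_pmf_def
proof (rule pmf_embed_pmf)
  let ?p = "\<lambda>x. (measure \<nu> {x})\<^sup>2 / atom_energy \<nu>"
  have "?p summable_on UNIV"
    using summable_on_cmult_left[OF summable_atom_squares, of "inverse (atom_energy \<nu>)"]
    by (simp add: divide_inverse)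
  then have "(\<integral>\<^sup>+x. ennreal (?p x) \<partial>count_space UNIV) = ennreal (infsum ?p UNIV)"
    using assms
    by (subst nn_integral_conv_infsetsum)
      (auto simp: infsetsum_infsum abs_summable_equivalent[symmetric])
  also have "infsum ?p UNIV = 1"
    using infsum_cmult_left'[of "\<lambda>x. (measure \<nu> {x})\<^sup>2" "inverse (atom_energy \<nu>)" UNIV] assms
    by (simp add: divide_inverse flip: atom_energy_def)
  finally show "(\<integral>\<^sup>+x. ennreal (?p x) \<partial>count_space UNIV) = 1" by simp
qed (use assms in simp)

end

lemma Homeo_bij:
  assumes "f \<in> Homeo"
  shows "bij (apply_bcontfun f)"
proof -
  obtain g where "homeomorphism UNIV UNIV (apply_bcontfun f) g" using assms by (auto simp: Homeo_def)
  then show ?thesis by (intro o_bij[of g]) (auto simp: homeomorphism_def)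
qed

lemma space_borel_prob: "\<mu> \<in> borel_prob S \<Longrightarrow> space \<mu> = S"
  using sets_eq_imp_space_eq[of \<mu> "restrict_space borel S"]
  by (simp add: borel_prob_def space_restrict_space)

lemma measure_conv_singleton:
  fixes \<nu> :: "'a::metric_space measure"
  assumes X: "compact (UNIV :: 'a set)" and \<mu>: "\<mu> \<in> borel_prob Homeo" and \<nu>: "\<nu> \<in> borel_prob UNIV"
  shows "integrable \<mu> (\<lambda>f. measure \<nu> (apply_bcontfun f -` {y}))"
    and "measure (conv \<mu> \<nu>) {y} = (LINT f|\<mu>. measure \<nu> (apply_bcontfun f -` {y}))"
proof -
  interpret \<mu>: prob_space \<mu> using \<mu> by (simp add: borel_prob_def)
  interpret \<nu>: prob_space \<nu> using \<nu> by (simp add: borel_prob_def)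
  let ?u = "\<lambda>f. measure \<nu> (apply_bcontfun f -` {y})"
  define A where "A = (\<lambda>(f, x). apply_bcontfun f x) -` {y} \<inter> space (\<mu> \<Otimes>\<^sub>M \<nu>)"
  have A: "A \<in> sets (\<mu> \<Otimes>\<^sub>M \<nu>)"
    unfolding A_def by (rule measurable_sets[OF measurable_eval[OF X \<mu> \<nu>]]) simp
  have slice: "Pair f -` A = apply_bcontfun f -` {y}" if "f \<in> space \<mu>" for f
    using that by (auto simp: A_def space_pair_measure space_borel_prob[OF \<nu>])
  have "(\<lambda>f. measure \<nu> (Pair f -` A)) \<in> borel_measurable \<mu>"
    unfolding measure_def using \<nu>.measurable_emeasure_Pair[OF A] by measurable
  then have "?u \<in> borel_measurable \<mu>" using slice by (simp cong: measurable_cong)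
  then show int: "integrable \<mu> ?u" by (intro \<mu>.integrable_const_bound[of _ 1]) auto
  have "emeasure (conv \<mu> \<nu>) {y} = emeasure (\<mu> \<Otimes>\<^sub>M \<nu>) A"
    unfolding conv_def A_def by (rule emeasure_distr[OF measurable_eval[OF X \<mu> \<nu>]]) simp
  also have "\<dots> = (\<integral>\<^sup>+f. emeasure \<nu> (Pair f -` A) \<partial>\<mu>)"
    by (rule \<nu>.emeasure_pair_measure_alt[OF A])
  also have "\<dots> = (\<integral>\<^sup>+f. ennreal (?u f) \<partial>\<mu>)"
    using slice by (intro nn_integral_cong) (simp add: \<nu>.emeasure_eq_measure)
  also have "\<dots> = ennreal (LINT f|\<mu>. ?u f)" by (rule nn_integral_eq_integral[OF int]) simp
  finally show "measure (conv \<mu> \<nu>) {y} = (LINT f|\<mu>. ?u f)"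
    by (simp add: measure_def)
qed

text \<open>
  A homeomorphism permutes the atoms, so sums over the atoms of \<open>f\<^sub>*\<nu>\<close> are reindexed sums over
  those of \<open>\<nu>\<close>.
\<close>

lemma infsum_preimage_singletons:
  assumes "f \<in> Homeo"
  shows "(\<Sum>\<^sub>\<infinity>y. g y (measure \<nu> (apply_bcontfun f -` {y}))) = (\<Sum>\<^sub>\<infinity>x. g (apply_bcontfun f x) (measure \<nu> {x}))"
    and "(\<lambda>y. g y (measure \<nu> (apply_bcontfun f -` {y}))) summable_on UNIV \<longleftrightarrow>
      (\<lambda>x. g (apply_bcontfun f x) (measure \<nu> {x})) summable_on UNIV"
proof -
  have "apply_bcontfun f -` {apply_bcontfun f x} = {x}" for x
    using bij_is_inj[OF Homeo_bij[OF assms]] by (auto simp: inj_eq)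
  then show "(\<Sum>\<^sub>\<infinity>y. g y (measure \<nu> (apply_bcontfun f -` {y}))) = (\<Sum>\<^sub>\<infinity>x. g (apply_bcontfun f x) (measure \<nu> {x}))"
    "(\<lambda>y. g y (measure \<nu> (apply_bcontfun f -` {y}))) summable_on UNIV \<longleftrightarrow>
      (\<lambda>x. g (apply_bcontfun f x) (measure \<nu> {x})) summable_on UNIV"
    using infsum_reindex_bij_betw[OF Homeo_bij[OF assms], of "\<lambda>y. g y (measure \<nu> (apply_bcontfun f -` {y}))"]
      summable_on_reindex_bij_betw[OF Homeo_bij[OF assms], of "\<lambda>y. g y (measure \<nu> (apply_bcontfun f -` {y}))"]
    by simp_all
qed

context
  fixes \<mu> :: "('a::metric_space \<Rightarrow>\<^sub>C 'a) measure" and \<nu> :: "'a measure"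
  assumes X: "compact (UNIV :: 'a set)" and \<mu>: "\<mu> \<in> borel_prob Homeo" and \<nu>: "\<nu> \<in> borel_prob UNIV"
begin

interpretation \<mu>: prob_space \<mu> using \<mu> by (simp add: borel_prob_def)
interpretation \<nu>: prob_space \<nu> using \<nu> by (simp add: borel_prob_def)

text \<open>
  In the notation of the introduction, \<open>conv_atom\<close> is the vector \<open>w\<close> and \<open>pushed_atom f\<close> is \<open>u\<^sub>f\<close>.
\<close>

abbreviation (input) "conv_atom \<equiv> \<lambda>y. measure (conv \<mu> \<nu>) {y}"
abbreviation (input) "pushed_atom \<equiv> \<lambda>f y. measure \<nu> (apply_bcontfun f -` {y})"

lemma conv_borel_prob: "conv \<mu> \<nu> \<in> borel_prob UNIV"
  by (rule conv_in_borel_prob[OF X \<mu> \<nu>])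

lemma conv_atom_le_one: "conv_atom y \<le> 1"
proof -
  interpret c: prob_space "conv \<mu> \<nu>" using conv_borel_prob by (simp add: borel_prob_def)
  show ?thesis by simp
qed

lemma pushforward_squares:
  assumes "f \<in> Homeo"
  shows "((\<lambda>y. (pushed_atom f y)\<^sup>2) has_sum atom_energy \<nu>) UNIV"
  unfolding has_sum_iff atom_energy_def
  using infsum_preimage_singletons[OF assms, of "\<lambda>_ t. t\<^sup>2" \<nu>] summable_atom_squares[OF \<nu>] by simp

lemma conv_squares: "((\<lambda>y. (conv_atom y)\<^sup>2) has_sum atom_energy (conv \<mu> \<nu>)) UNIV"
  unfolding has_sum_iff atom_energy_def using summable_atom_squares[OF conv_borel_prob] by simp

lemma summable_cross:
  assumes "f \<in> Homeo"
  shows "(\<lambda>y. pushed_atom f y * conv_atom y) summable_on UNIV"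
proof (rule summable_on_dominated)
  show "pushed_atom f summable_on UNIV"
    using infsum_preimage_singletons(2)[OF assms, of "\<lambda>_ t. t" \<nu>] summable_atoms[OF \<nu>] by simp
  show "\<bar>pushed_atom f y * conv_atom y\<bar> \<le> pushed_atom f y" for y
    using mult_left_mono[OF conv_atom_le_one, of "pushed_atom f y" y] by (simp add: abs_mult)
qed

text \<open>
  The inner product \<open>\<langle>u\<^sub>f, w\<rangle>\<close> is bounded below by finite partial sums. These are integrated over
  \<open>f\<close> term by term, which computes \<open>\<integral> \<parallel>u\<^sub>f - w\<parallel>\<^sup>2 d\<mu>(f)\<close> up to an arbitrarily small error with
  finite sums only.
\<close>

lemma cross_ge_finite:
  assumes "f \<in> Homeo" "finite Y"
  shows "(\<Sum>y\<in>Y. pushed_atom f y * conv_atom y) \<le> (\<Sum>\<^sub>\<infinity>y. pushed_atom f y * conv_atom y)"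
  by (rule finite_sum_le_infsum[OF summable_cross[OF assms(1)] assms(2)]) auto

lemma integral_cross:
  assumes "finite Y"
  shows "integrable \<mu> (\<lambda>f. \<Sum>y\<in>Y. pushed_atom f y * conv_atom y)"
    and "(LINT f|\<mu>. (\<Sum>y\<in>Y. pushed_atom f y * conv_atom y)) = (\<Sum>y\<in>Y. (conv_atom y)\<^sup>2)"
  using measure_conv_singleton[OF X \<mu> \<nu>]
  by (auto simp: power2_eq_square)

lemma distance_nonneg:
  assumes "f \<in> Homeo"
  shows "2 * (\<Sum>\<^sub>\<infinity>y. pushed_atom f y * conv_atom y) \<le> atom_energy \<nu> + atom_energy (conv \<mu> \<nu>)"
proof (rule has_sum_mono)
  show "((\<lambda>y. 2 * (pushed_atom f y * conv_atom y)) has_sum 2 * (\<Sum>\<^sub>\<infinity>y. pushed_atom f y * conv_atom y)) UNIV"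
    by (intro has_sum_cmult_right has_sum_infsum summable_cross[OF assms])
  show "((\<lambda>y. (pushed_atom f y)\<^sup>2 + (conv_atom y)\<^sup>2) has_sum atom_energy \<nu> + atom_energy (conv \<mu> \<nu>)) UNIV"
    by (intro has_sum_add pushforward_squares[OF assms] conv_squares)
  show "2 * (pushed_atom f y * conv_atom y) \<le> (pushed_atom f y)\<^sup>2 + (conv_atom y)\<^sup>2" for y
    using sum_squares_bound[of "pushed_atom f y" "conv_atom y"] by (simp add: mult_ac)
qed

text \<open>
  Integrate \<open>2 \<langle>u\<^sub>f, w\<rangle> \<le> \<parallel>u\<^sub>f\<parallel>\<^sup>2 + \<parallel>w\<parallel>\<^sup>2\<close>; the left-hand side has mean \<open>2 \<parallel>w\<parallel>\<^sup>2\<close>.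
\<close>

lemma atom_energy_conv_le: "atom_energy (conv \<mu> \<nu>) \<le> atom_energy \<nu>"
proof -
  have "(\<Sum>y\<in>Y. (conv_atom y)\<^sup>2) \<le> (atom_energy \<nu> + atom_energy (conv \<mu> \<nu>)) / 2" if Y: "finite Y" for Y
  proof -
    have "(LINT f|\<mu>. (\<Sum>y\<in>Y. pushed_atom f y * conv_atom y)) \<le> (LINT f|\<mu>. (atom_energy \<nu> + atom_energy (conv \<mu> \<nu>)) / 2)"
    proof (rule integral_mono[OF integral_cross(1)[OF Y]])
      fix f assume "f \<in> space \<mu>"
      then have "f \<in> Homeo" by (simp add: space_borel_prob[OF \<mu>])
      have half: "a \<le> C \<Longrightarrow> 2 * C \<le> q \<Longrightarrow> a \<le> q / 2" for a C q :: real by simp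
      show "(\<Sum>y\<in>Y. pushed_atom f y * conv_atom y) \<le> (atom_energy \<nu> + atom_energy (conv \<mu> \<nu>)) / 2"
        by (rule half[OF cross_ge_finite[OF \<open>f \<in> Homeo\<close> Y] distance_nonneg[OF \<open>f \<in> Homeo\<close>]])
    qed simp
    then show ?thesis using integral_cross(2)[OF Y] by (simp add: \<mu>.prob_space)
  qed
  then have "atom_energy (conv \<mu> \<nu>) \<le> (atom_energy \<nu> + atom_energy (conv \<mu> \<nu>)) / 2"
    by (intro has_sum_le_finite_sums[OF conv_squares])
  then show ?thesis by simp
qed

text \<open>
  Both sides of the difference are sums of \<open>\<phi>\<close> against squares, and
  \<open>\<bar>u\<^sup>2 - w\<^sup>2\<bar> = \<bar>u - w\<bar> \<bar>u + w\<bar> \<le> (u - w)\<^sup>2 / (2 \<tau>) + \<tau> (u\<^sup>2 + w\<^sup>2)\<close>. The weighted inequality with the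
  free parameter \<open>\<tau>\<close> takes the place of the Cauchy-Schwarz inequality for infinite sums.
\<close>

lemma discrepancy_pointwise:
  assumes pos: "atom_energy \<nu> > 0" and \<tau>: "\<tau> > 0" and f: "f \<in> Homeo" and \<phi>: "\<phi> \<in> bounded_lipschitz_tests"
  shows "\<bar>measure_pmf.expectation (atom_energy_pmf \<nu>) (\<lambda>x. \<phi> (apply_bcontfun f x)) -
      (\<Sum>\<^sub>\<infinity>y. \<phi> y * (conv_atom y)\<^sup>2) / atom_energy \<nu>\<bar> \<le>
    (atom_energy \<nu> + atom_energy (conv \<mu> \<nu>) - 2 * (\<Sum>\<^sub>\<infinity>y. pushed_atom f y * conv_atom y)) / (2 * \<tau> * atom_energy \<nu>) + 2 * \<tau>"
proof -
  let ?Q = "atom_energy \<nu>" and ?Q' = "atom_energy (conv \<mu> \<nu>)" and ?C = "\<Sum>\<^sub>\<infinity>y. pushed_atom f y * conv_atom y"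
  have \<phi>_le: "\<bar>\<phi> x\<bar> \<le> 1" for x using \<phi> by (simp add: bounded_lipschitz_tests_def)
  have summable: "(\<lambda>y. \<phi> y * g y) summable_on UNIV" if g: "(g has_sum s) UNIV" "\<And>y. 0 \<le> g y" for g s
  proof (rule summable_on_dominated)
    show "g summable_on UNIV" using g(1) by (rule has_sum_imp_summable)
    show "\<bar>\<phi> y * g y\<bar> \<le> g y" for y
      using mult_right_mono[OF \<phi>_le g(2), of y y] g(2)[of y] by (simp add: abs_mult)
  qed
  have sum_u: "(\<lambda>y. \<phi> y * (pushed_atom f y)\<^sup>2) summable_on UNIV"
    by (rule summable[OF pushforward_squares[OF f]]) simp
  have sum_w: "(\<lambda>y. \<phi> y * (conv_atom y)\<^sup>2) summable_on UNIV"
    by (rule summable[OF conv_squares]) simp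
  have "measure_pmf.expectation (atom_energy_pmf \<nu>) (\<lambda>x. \<phi> (apply_bcontfun f x)) =
      (\<Sum>\<^sub>\<infinity>x. (\<phi> (apply_bcontfun f x) * (measure \<nu> {x})\<^sup>2) * inverse ?Q)"
    using pmf_expectation_eq_infsum[of "\<lambda>x. \<phi> (apply_bcontfun f x)" 1 "atom_energy_pmf \<nu>", OF \<phi>_le]
    by (simp only: pmf_atom_energy_pmf[OF \<nu> pos] divide_inverse mult_ac)
  also have "\<dots> = (\<Sum>\<^sub>\<infinity>y. \<phi> y * (pushed_atom f y)\<^sup>2) / ?Q"
    using infsum_preimage_singletons(1)[OF f, of "\<lambda>y t. \<phi> y * t\<^sup>2" \<nu>]
    by (simp add: infsum_cmult_left' divide_inverse)
  finally have "measure_pmf.expectation (atom_energy_pmf \<nu>) (\<lambda>x. \<phi> (apply_bcontfun f x)) -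
      (\<Sum>\<^sub>\<infinity>y. \<phi> y * (conv_atom y)\<^sup>2) / ?Q = ((\<Sum>\<^sub>\<infinity>y. \<phi> y * (pushed_atom f y)\<^sup>2) - (\<Sum>\<^sub>\<infinity>y. \<phi> y * (conv_atom y)\<^sup>2)) / ?Q" (is "?L = _")
    by (simp add: diff_divide_distrib)
  then have "\<bar>?L\<bar> = \<bar>\<Sum>\<^sub>\<infinity>y. \<phi> y * (pushed_atom f y)\<^sup>2 - \<phi> y * (conv_atom y)\<^sup>2\<bar> / ?Q"
    using pos infsumI[OF has_sum_subtract[OF has_sum_infsum[OF sum_u] has_sum_infsum[OF sum_w]]] by (simp add: abs_divide)
  also have "\<bar>\<Sum>\<^sub>\<infinity>y. \<phi> y * (pushed_atom f y)\<^sup>2 - \<phi> y * (conv_atom y)\<^sup>2\<bar> \<le>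
      (1 / (2 * \<tau>) + \<tau>) * ?Q + (1 / (2 * \<tau>) + \<tau>) * ?Q' - (1 / \<tau>) * ?C" (is "_ \<le> ?R")
  proof -
    let ?d = "\<lambda>y. \<phi> y * (pushed_atom f y)\<^sup>2 - \<phi> y * (conv_atom y)\<^sup>2"
    let ?b = "\<lambda>y. (1 / (2 * \<tau>) + \<tau>) * (pushed_atom f y)\<^sup>2 + (1 / (2 * \<tau>) + \<tau>) * (conv_atom y)\<^sup>2 - (1 / \<tau>) * (pushed_atom f y * conv_atom y)"
    have R: "(?b has_sum ?R) UNIV"
      by (intro has_sum_subtract has_sum_add has_sum_cmult_right pushforward_squares[OF f] conv_squares
          has_sum_infsum summable_cross[OF f])
    have d: "\<bar>?d y\<bar> \<le> ?b y" for y
    proof -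
      define a b where "a = pushed_atom f y" and "b = conv_atom y"
      have "\<bar>?d y\<bar> = \<bar>\<phi> y\<bar> * \<bar>a\<^sup>2 - b\<^sup>2\<bar>"
        by (simp add: a_def b_def abs_mult flip: right_diff_distrib)
      also have "\<dots> \<le> \<bar>a\<^sup>2 - b\<^sup>2\<bar>"
        using mult_right_mono[OF \<phi>_le, of "\<bar>a\<^sup>2 - b\<^sup>2\<bar>" y] by simp
      also have "\<bar>a\<^sup>2 - b\<^sup>2\<bar> = \<bar>a - b\<bar> * \<bar>a + b\<bar>"
        by (simp add: power2_eq_square square_diff_square_factored abs_mult mult.commute)
      also have "\<dots> \<le> \<bar>a - b\<bar>\<^sup>2 / (2 * \<tau>) + \<tau> / 2 * \<bar>a + b\<bar>\<^sup>2"
      proof -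
        have "0 \<le> (\<bar>a - b\<bar> - \<tau> * \<bar>a + b\<bar>)\<^sup>2 / (2 * \<tau>)" using \<tau> by simp
        also have "\<dots> = \<bar>a - b\<bar>\<^sup>2 / (2 * \<tau>) + \<tau> / 2 * \<bar>a + b\<bar>\<^sup>2 - \<bar>a - b\<bar> * \<bar>a + b\<bar>"
          using \<tau> by (simp add: power2_diff field_simps) (simp add: power2_eq_square)
        finally show ?thesis by simp
      qed
      also have "\<dots> \<le> (a - b)\<^sup>2 / (2 * \<tau>) + \<tau> * (a\<^sup>2 + b\<^sup>2)"
      proof -
        have "(a + b)\<^sup>2 \<le> 2 * (a\<^sup>2 + b\<^sup>2)" using sum_squares_bound[of a b] by (simp add: power2_sum)
        from mult_left_mono[OF this, of "\<tau> / 2"] show ?thesis using \<tau> by simp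
      qed
      also have "\<dots> = ?b y"
        using \<tau> unfolding a_def[symmetric] b_def[symmetric] by (simp add: power2_diff field_simps)
      finally show ?thesis .
    qed
    have sum_b: "?b summable_on UNIV" "infsum ?b UNIV = ?R" using R by (auto simp: has_sum_iff)
    have "(\<lambda>y. norm (?d y)) summable_on UNIV"
      using d by (intro Infinite_Sum.abs_summable_on_comparison_test'[OF sum_b(1)]) simp
    then have "\<bar>infsum ?d UNIV\<bar> \<le> (\<Sum>\<^sub>\<infinity>y. \<bar>?d y\<bar>)" "(\<lambda>y. \<bar>?d y\<bar>) summable_on UNIV"
      using norm_infsum_bound[of ?d UNIV] by auto
    moreover have "(\<Sum>\<^sub>\<infinity>y. \<bar>?d y\<bar>) \<le> infsum ?b UNIV"
      using d calculation(2) sum_b(1) by (intro infsum_mono)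
    ultimately show ?thesis using sum_b(2) by linarith
  qed
  also have "?R / ?Q \<le> ((?Q + ?Q' - 2 * ?C) / (2 * \<tau>) + 2 * \<tau> * ?Q) / ?Q"
  proof (rule divide_right_mono)
    have "?R = (?Q + ?Q' - 2 * ?C) / (2 * \<tau>) + \<tau> * (?Q + ?Q')"
      using \<tau> by (simp add: field_simps)
    also have "\<tau> * (?Q + ?Q') \<le> \<tau> * (2 * ?Q)" using \<tau> atom_energy_conv_le by simp
    finally show "?R \<le> (?Q + ?Q' - 2 * ?C) / (2 * \<tau>) + 2 * \<tau> * ?Q" by (simp add: mult_ac)
  qed (use pos in simp)
  also have "\<dots> = (?Q + ?Q' - 2 * ?C) / (2 * \<tau> * ?Q) + 2 * \<tau>"
    using pos by (simp add: add_divide_distrib)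
  finally show ?thesis using pos by (simp add: divide_right_mono)
qed

text \<open>
  As target take \<open>\<phi> \<mapsto> \<Sum>\<^sub>y \<phi>(y) w(y)\<^sup>2 / Q(\<nu>)\<close>. Integrating the pointwise bound gives
  \<open>c \<le> (1 - Q(\<mu> * \<nu>) / Q(\<nu>)) / (2 \<tau>) + 2 \<tau>\<close>, and \<open>\<tau> = c / 4\<close> yields the factor.
\<close>

lemma atom_energy_contracts:
  assumes c: "c > 0"
    and discr: "\<And>\<alpha>. (\<And>\<phi>. \<bar>\<alpha> \<phi>\<bar> \<le> 1) \<Longrightarrow> c \<le> (LINT f|\<mu>. discrepancy (atom_energy_pmf \<nu>) \<alpha> f)"
  shows "atom_energy (conv \<mu> \<nu>) \<le> (1 - c\<^sup>2 / 4) * atom_energy \<nu>"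
proof (cases "atom_energy \<nu> = 0")
  case True
  then show ?thesis using atom_energy_conv_le by simp
next
  case False
  let ?Q = "atom_energy \<nu>" and ?Q' = "atom_energy (conv \<mu> \<nu>)"
  have pos: "?Q > 0" using False atom_energy_nonneg[OF \<nu>] by linarith
  define \<alpha> where "\<alpha> \<phi> = (if \<phi> \<in> bounded_lipschitz_tests then (\<Sum>\<^sub>\<infinity>y. \<phi> y * (conv_atom y)\<^sup>2) / ?Q else 0)" for \<phi>
  have \<alpha>: "\<bar>\<alpha> \<phi>\<bar> \<le> 1" for \<phi>
  proof (cases "\<phi> \<in> bounded_lipschitz_tests")
    case True
    have \<phi>: "\<bar>\<phi> y\<bar> \<le> 1" for y using True by (simp add: bounded_lipschitz_tests_def)
    have le: "\<bar>\<phi> y * (conv_atom y)\<^sup>2\<bar> \<le> (conv_atom y)\<^sup>2" for y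
      using mult_right_mono[OF \<phi>, of "(conv_atom y)\<^sup>2" y] by (simp add: abs_mult)
    have sum: "(\<lambda>y. norm (\<phi> y * (conv_atom y)\<^sup>2)) summable_on UNIV"
      by (rule Infinite_Sum.abs_summable_on_comparison_test'[OF has_sum_imp_summable[OF conv_squares]])
        (use le in simp)
    have "\<bar>\<Sum>\<^sub>\<infinity>y. \<phi> y * (conv_atom y)\<^sup>2\<bar> \<le> (\<Sum>\<^sub>\<infinity>y. norm (\<phi> y * (conv_atom y)\<^sup>2))"
      using norm_infsum_bound[OF sum] by simp
    also have "\<dots> \<le> ?Q'"
      unfolding infsumI[OF conv_squares, symmetric]
      using le by (intro infsum_mono sum has_sum_imp_summable[OF conv_squares]) simp
    also have "\<dots> \<le> ?Q" by (rule atom_energy_conv_le)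
    finally show ?thesis using pos True by (simp add: \<alpha>_def abs_divide)
  qed (simp add: \<alpha>_def)
  define \<tau> where "\<tau> = c / 4"
  have \<tau>: "\<tau> > 0" using c by (simp add: \<tau>_def)
  have le: "c \<le> (?Q + ?Q' - 2 * (\<Sum>y\<in>Y. (conv_atom y)\<^sup>2)) / (2 * \<tau> * ?Q) + 2 * \<tau>" if Y: "finite Y" for Y
  proof -
    let ?b = "\<lambda>f. (?Q + ?Q' - 2 * (\<Sum>y\<in>Y. pushed_atom f y * conv_atom y)) / (2 * \<tau> * ?Q) + 2 * \<tau>"
    have "(LINT f|\<mu>. discrepancy (atom_energy_pmf \<nu>) \<alpha> f) \<le> (LINT f|\<mu>. ?b f)"
    proof (rule integral_mono)
      show "integrable \<mu> (discrepancy (atom_energy_pmf \<nu>) \<alpha>)"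
        by (rule bounded_nonexpansive_integrable[OF discrepancy_bounded_nonexpansive[OF \<alpha>] \<mu>])
      show "integrable \<mu> ?b" using integral_cross(1)[OF Y] by simp
      fix f assume "f \<in> space \<mu>"
      then have f: "f \<in> Homeo" by (simp add: space_borel_prob[OF \<mu>])
      show "discrepancy (atom_energy_pmf \<nu>) \<alpha> f \<le> ?b f"
        unfolding discrepancy_def
      proof (rule cSUP_least[OF bounded_lipschitz_tests_nonempty])
        fix \<phi> :: "'a \<Rightarrow> real" assume \<phi>: "\<phi> \<in> bounded_lipschitz_tests"
        have "\<bar>measure_pmf.expectation (atom_energy_pmf \<nu>) (\<lambda>x. \<phi> (apply_bcontfun f x)) - \<alpha> \<phi>\<bar> \<le>
            (?Q + ?Q' - 2 * (\<Sum>\<^sub>\<infinity>y. pushed_atom f y * conv_atom y)) / (2 * \<tau> * ?Q) + 2 * \<tau>"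
          using discrepancy_pointwise[OF pos \<tau> f \<phi>] \<phi> by (simp add: \<alpha>_def)
        also have "\<dots> \<le> ?b f"
          using cross_ge_finite[OF f Y] pos \<tau> by (intro add_right_mono divide_right_mono) auto
        finally show "\<bar>measure_pmf.expectation (atom_energy_pmf \<nu>) (\<lambda>x. \<phi> (apply_bcontfun f x)) - \<alpha> \<phi>\<bar> \<le> ?b f" .
      qed
    qed
    also have "\<dots> = (?Q + ?Q' - 2 * (\<Sum>y\<in>Y. (conv_atom y)\<^sup>2)) / (2 * \<tau> * ?Q) + 2 * \<tau>"
      using integral_cross[OF Y] by (simp add: \<mu>.prob_space)
    finally show ?thesis using discr[of \<alpha>, OF \<alpha>] by linarith
  qed
  have "(\<Sum>y\<in>Y. (conv_atom y)\<^sup>2) \<le> (?Q + ?Q' - c\<^sup>2 / 4 * ?Q) / 2" if Y: "finite Y" for Y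
  proof -
    have "c / 2 \<le> (?Q + ?Q' - 2 * (\<Sum>y\<in>Y. (conv_atom y)\<^sup>2)) / (2 * \<tau> * ?Q)"
      using le[OF Y] \<tau>_def by linarith
    then have "c / 2 * (2 * \<tau> * ?Q) \<le> ?Q + ?Q' - 2 * (\<Sum>y\<in>Y. (conv_atom y)\<^sup>2)"
      using \<tau> pos by (subst (asm) pos_le_divide_eq) auto
    then show ?thesis by (simp add: power2_eq_square \<tau>_def)
  qed
  then have "?Q' \<le> (?Q + ?Q' - c\<^sup>2 / 4 * ?Q) / 2"
    by (intro has_sum_le_finite_sums[OF conv_squares])
  then show ?thesis by (simp add: algebra_simps)
qed

end

section \<open>Vanishing discrepancy and deterministic images\<close>

lemma (in prob_space) AE_imp_ex: "AE x in M. P x \<Longrightarrow> \<exists>x\<in>space M. P x"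
proof (rule ccontr)
  assume "AE x in M. P x" "\<not> (\<exists>x\<in>space M. P x)"
  then have "AE x in M. False" by (auto elim: AE_mp intro!: AE_I2)
  then show False by simp
qed

lemma indicator_closed_approx:
  assumes "closed C" "C \<noteq> {}"
  shows "(\<lambda>k. max 0 (1 - real (Suc k) * infdist x C)) \<longlonglongrightarrow> indicator C x"
proof (cases "x \<in> C")
  case True
  then show ?thesis by simp
next
  case False
  then have d: "infdist x C > 0"
    using in_closed_iff_infdist_zero[OF assms, of x] infdist_nonneg[of x C] by linarith
  obtain N where N: "inverse (real (Suc N)) < infdist x C" using reals_Archimedean[OF d] by blast
  have "\<forall>\<^sub>F k in sequentially. max 0 (1 - real (Suc k) * infdist x C) = 0"
  proof (rule eventually_sequentiallyI[of N])
    fix k assume "N \<le> k"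
    then have "real (Suc N) * infdist x C \<le> real (Suc k) * infdist x C"
      using d by (intro mult_right_mono) auto
    moreover have "1 < real (Suc N) * infdist x C" using N by (simp add: field_simps)
    ultimately show "max 0 (1 - real (Suc k) * infdist x C) = 0" by simp
  qed
  then show ?thesis using False by (simp add: tendsto_eventually)
qed

lemma lebesgue_closed_approx:
  fixes \<rho> :: "'b measure" and g :: "'b \<Rightarrow> 'a::metric_space"
  assumes "prob_space \<rho>" "g \<in> borel_measurable \<rho>" "closed C" "C \<noteq> {}"
  shows "(\<lambda>k. LINT x|\<rho>. max 0 (1 - real (Suc k) * infdist (g x) C))
    \<longlonglongrightarrow> measure \<rho> (g -` C \<inter> space \<rho>)"
proof -
  interpret prob_space \<rho> by fact
  have "(\<lambda>k. LINT x|\<rho>. max 0 (1 - real (Suc k) * infdist (g x) C)) \<longlonglongrightarrow> (LINT x|\<rho>. indicator C (g x))"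
  proof (rule integral_dominated_convergence[where w = "\<lambda>_. 1"])
    note assms(2)[measurable]
    have [measurable]: "C \<in> sets borel" using assms(3) by simp
    show "(\<lambda>x. indicator C (g x) :: real) \<in> borel_measurable \<rho>" by measurable
    have "continuous_on UNIV (\<lambda>y. max 0 (1 - real (Suc k) * infdist y C))" for k
      by (intro continuous_intros)
    from borel_measurable_continuous_onI[OF this]
    show "(\<lambda>x. max 0 (1 - real (Suc k) * infdist (g x) C)) \<in> borel_measurable \<rho>" for k
      by (rule measurable_compose[OF assms(2)])
    show "AE x in \<rho>. (\<lambda>k. max 0 (1 - real (Suc k) * infdist (g x) C)) \<longlonglongrightarrow> indicator C (g x)"
      by (intro AE_I2 indicator_closed_approx assms)
    show "AE x in \<rho>. norm (max 0 (1 - real (Suc k) * infdist (g x) C)) \<le> 1" for k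
      by (intro AE_I2) (simp add: infdist_nonneg)
  qed simp
  also have "(LINT x|\<rho>. indicator C (g x)) = (LINT x|\<rho>. indicator (g -` C \<inter> space \<rho>) x :: real)"
    by (intro Bochner_Integration.integral_cong) (auto simp: indicator_def)
  also have "\<dots> = measure \<rho> (g -` C \<inter> space \<rho>)"
    using measurable_sets[OF assms(2), of C] assms(3) by simp
  finally show ?thesis .
qed

text \<open>
  A Borel probability measure is determined by countably many of its values. The generating sets are chosen closed
  because the measure of a closed set is a limit of integrals of Lipschitz functions.
\<close>

lemma countable_closed_generator:
  assumes X: "compact (UNIV :: 'a::metric_space set)"
  obtains G :: "'a::metric_space set set" where
    "countable G" "\<And>C. C \<in> G \<Longrightarrow> closed C" "Int_stable G" "UNIV \<in> G" "sets borel = sigma_sets UNIV G"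
proof -
  obtain D :: "'a set" where D: "countable D" "\<And>x e. e > 0 \<Longrightarrow> \<exists>d\<in>D. dist x d < e"
    using countable_dense_compact[OF X] by blast
  define B where "B = (\<lambda>(d, q). cball d q) ` (D \<times> \<rat>)"
  have B: "countable B" using D(1) by (auto simp: B_def intro!: countable_rat countable_SIGMA)
  define G where "G = Inter ` {F. F \<subseteq> B \<and> finite F}"
  have "countable G"
    unfolding G_def using countable_Collect_finite_subset[OF B] by (auto simp: conj_commute)
  have closed: "closed C" if "C \<in> G" for C
    using that by (auto simp: G_def B_def)
  have "Int_stable G"
  proof (rule Int_stableI)
    fix a b assume "a \<in> G" "b \<in> G"
    then obtain F F' where "F \<subseteq> B" "finite F" "a = \<Inter>F" "F' \<subseteq> B" "finite F'" "b = \<Inter>F'"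
      by (auto simp: G_def)
    then show "a \<inter> b \<in> G"
      unfolding G_def by (intro image_eqI[of _ _ "F \<union> F'"]) auto
  qed
  have "UNIV \<in> G" unfolding G_def by (intro image_eqI[of _ _ "{}"]) auto
  have B_G: "B \<subseteq> G"
  proof
    fix b assume "b \<in> B"
    then show "b \<in> G" unfolding G_def by (intro image_eqI[of _ _ "{b}"]) auto
  qed
  have "U \<in> sigma_sets UNIV G" if "open U" for U
  proof -
    have "U = \<Union>{b \<in> B. b \<subseteq> U}"
    proof (intro equalityI subsetI)
      fix x assume "x \<in> U"
      then obtain e where e: "e > 0" "cball x e \<subseteq> U" using \<open>open U\<close> open_contains_cball by blast
      obtain d where d: "d \<in> D" "dist x d < e / 2" using D(2)[of "e / 2" x] e(1) by auto
      obtain q where q: "q \<in> \<rat>" "dist x d < q" "q < e / 2" using Rats_dense_in_real[OF d(2)] by blast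
      have "cball d q \<subseteq> cball x e"
      proof
        fix z assume "z \<in> cball d q"
        then have "dist d z \<le> q" by simp
        then have "dist x z \<le> e" using dist_triangle[of x z d] q by linarith
        then show "z \<in> cball x e" by simp
      qed
      moreover have "cball d q \<in> B" using d(1) q(1) by (auto simp: B_def)
      moreover have "x \<in> cball d q" using q(2) by (simp add: dist_commute)
      ultimately show "x \<in> \<Union>{b \<in> B. b \<subseteq> U}" using e(2) by blast
    qed auto
    moreover have "\<Union>{b \<in> B. b \<subseteq> U} \<in> sigma_sets UNIV G"
    proof (rule sigma_sets_UNION)
      show "countable {b \<in> B. b \<subseteq> U}" using B by (rule countable_subset[rotated]) auto
      show "b \<in> sigma_sets UNIV G" if "b \<in> {b \<in> B. b \<subseteq> U}" for b
        using that B_G by (auto intro: sigma_sets.Basic)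
    qed
    ultimately show ?thesis by simp
  qed
  then have "sigma_sets UNIV (Collect open) \<subseteq> sigma_sets UNIV G"
    by (intro sigma_sets_mono) auto
  moreover have "sigma_sets UNIV G \<subseteq> sets borel"
  proof -
    have "G \<subseteq> sets borel" using closed by auto
    from sets.sigma_sets_subset[OF this] show ?thesis by simp
  qed
  ultimately have "sets borel = sigma_sets UNIV G"
    by (auto simp: borel_def)
  with \<open>countable G\<close> closed \<open>Int_stable G\<close> \<open>UNIV \<in> G\<close> show thesis by (rule that)
qed

lemma continuous_borel_prob_measurable:
  fixes \<rho> :: "'a::metric_space measure"
  assumes "\<rho> \<in> borel_prob UNIV" "continuous_on UNIV g"
  shows "g \<in> borel_measurable \<rho>"
  using borel_measurable_continuous_onI[OF assms(2)]
  by (simp add: measurable_cong_sets[OF sets_borel_prob[OF assms(1)] refl])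

text \<open>
  The atoms of weight at least \<open>e\<close> accumulate at some point \<open>z\<close>, and every continuous bump of
  height \<open>1\<close> at \<open>z\<close> has integral at least \<open>e\<close> in the limit.
\<close>

lemma weak_limit_atom:
  fixes \<rho> :: "'a::metric_space measure"
  assumes X: "compact (UNIV :: 'a set)" and \<rho>: "\<rho> \<in> borel_prob UNIV"
    and weak: "\<And>\<phi> :: 'a \<Rightarrow> real. continuous_on UNIV \<phi> \<Longrightarrow>
      (\<lambda>n. measure_pmf.expectation (p n) \<phi>) \<longlonglongrightarrow> (LINT x|\<rho>. \<phi> x)"
    and e: "\<And>n. \<exists>x. e \<le> pmf (p n) x"
  shows "\<exists>x. e \<le> measure \<rho> {x}"
proof -
  interpret \<rho>: prob_space \<rho> using \<rho> by (simp add: borel_prob_def)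
  obtain x where x: "\<And>n. e \<le> pmf (p n) (x n)" using e by metis
  obtain z r where r: "strict_mono (r :: nat \<Rightarrow> nat)" and "(x \<circ> r) \<longlonglongrightarrow> z"
    using seq_compactE[OF compact_imp_seq_compact[OF X]] by (metis UNIV_I)
  then have z: "(\<lambda>n. x (r n)) \<longlonglongrightarrow> z" by (simp add: comp_def)
  let ?\<phi> = "\<lambda>k y. max 0 (1 - real (Suc k) * infdist y {z})"
  have "e \<le> (LINT y|\<rho>. ?\<phi> k y)" for k
  proof -
    have cont: "continuous_on UNIV (?\<phi> k)" by (intro continuous_intros)
    have "(\<lambda>n. ?\<phi> k (x (r n))) \<longlonglongrightarrow> ?\<phi> k z"
      by (rule continuous_on_tendsto_compose[OF cont z]) auto
    then have "(\<lambda>n. e * ?\<phi> k (x (r n))) \<longlonglongrightarrow> e * ?\<phi> k z" by (rule tendsto_mult_left)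
    moreover have "(\<lambda>n. measure_pmf.expectation (p (r n)) (?\<phi> k)) \<longlonglongrightarrow> (LINT y|\<rho>. ?\<phi> k y)"
      using LIMSEQ_subseq_LIMSEQ[OF weak[OF cont] r] by (simp add: comp_def)
    moreover have "e * ?\<phi> k (x (r n)) \<le> measure_pmf.expectation (p (r n)) (?\<phi> k)" for n
    proof -
      have bd: "0 \<le> ?\<phi> k y" "?\<phi> k y \<le> 1" for y by (simp_all add: infdist_nonneg)
      have "e * ?\<phi> k (x (r n)) \<le> pmf (p (r n)) (x (r n)) * ?\<phi> k (x (r n))"
        using x bd by (intro mult_right_mono)
      also have "\<dots> = measure_pmf.expectation (p (r n)) (\<lambda>y. indicator {x (r n)} y * ?\<phi> k (x (r n)))"
        by (simp add: measure_pmf_single)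
      also have "\<dots> \<le> measure_pmf.expectation (p (r n)) (?\<phi> k)"
        using bd by (intro integral_mono measure_pmf.integrable_const_bound[of _ 1])
          (auto simp: indicator_def)
      finally show ?thesis .
    qed
    ultimately have "e * ?\<phi> k z \<le> (LINT y|\<rho>. ?\<phi> k y)" by (blast intro: LIMSEQ_le)
    then show ?thesis by simp
  qed
  moreover have "(\<lambda>k. LINT y|\<rho>. ?\<phi> k y) \<longlonglongrightarrow> measure \<rho> ((\<lambda>y. y) -` {z} \<inter> space \<rho>)"
    by (intro lebesgue_closed_approx \<rho>.prob_space_axioms continuous_borel_prob_measurable[OF \<rho>]) auto
  ultimately have "e \<le> measure \<rho> ((\<lambda>y. y) -` {z} \<inter> space \<rho>)"
    by (intro LIMSEQ_le_const) auto
  then show ?thesis by (intro exI[of _ z]) (simp add: space_borel_prob[OF \<rho>])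
qed

context
  fixes \<mu> :: "('a::metric_space \<Rightarrow>\<^sub>C 'a) measure" and \<rho> :: "'a measure"
  assumes X: "compact (UNIV :: 'a set)" and \<mu>: "\<mu> \<in> borel_prob Homeo"
    and \<rho>: "\<rho> \<in> borel_prob UNIV"
begin

interpretation \<mu>: prob_space \<mu> using \<mu> by (simp add: borel_prob_def)
interpretation \<rho>: prob_space \<rho> using \<rho> by (simp add: borel_prob_def)

text \<open>
  Along a subsequence the targets of \<open>\<phi>\<close> converge to a number \<open>a\<close>. By dominated convergence
  \<open>\<integral> \<bar>\<integral> \<phi> \<circ> f d\<rho> - a\<bar> d\<mu>(f)\<close> is a limit of integrals that are dominated by the mean
  discrepancies, so it is \<open>0\<close>.
\<close>

lemma integral_AE_const:
  assumes weak: "\<And>\<phi> :: 'a \<Rightarrow> real. continuous_on UNIV \<phi> \<Longrightarrow>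
      (\<lambda>n. measure_pmf.expectation (p n) \<phi>) \<longlonglongrightarrow> (LINT x|\<rho>. \<phi> x)"
    and \<alpha>: "\<And>n \<phi>. \<bar>\<alpha> n \<phi>\<bar> \<le> 1"
    and small: "(\<lambda>n. LINT f|\<mu>. discrepancy (p n) (\<alpha> n) f) \<longlonglongrightarrow> 0"
    and \<phi>: "\<phi> \<in> bounded_lipschitz_tests"
  shows "\<exists>a. AE f in \<mu>. (LINT x|\<rho>. \<phi> (apply_bcontfun f x)) = a"
proof -
  have "\<forall>n. \<alpha> n \<phi> \<in> {- 1..1}" using \<alpha> by (auto simp: abs_le_iff minus_le_iff)
  then obtain a r where r: "strict_mono (r :: nat \<Rightarrow> nat)" and "((\<lambda>n. \<alpha> n \<phi>) \<circ> r) \<longlonglongrightarrow> a"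
    using seq_compactE[OF compact_imp_seq_compact[OF compact_Icc]] by metis
  then have a: "(\<lambda>n. \<alpha> (r n) \<phi>) \<longlonglongrightarrow> a" by (simp add: comp_def)
  let ?E = "\<lambda>n f. measure_pmf.expectation (p (r n)) (\<lambda>x. \<phi> (apply_bcontfun f x))"
  let ?X = "\<lambda>n f. \<bar>?E n f - \<alpha> (r n) \<phi>\<bar>"
  let ?Y = "\<lambda>f. \<bar>(LINT x|\<rho>. \<phi> (apply_bcontfun f x)) - a\<bar>"
  have "(\<lambda>n. ?E n f) \<longlonglongrightarrow> (LINT x|\<rho>. \<phi> (apply_bcontfun f x))" for f
  proof -
    have "continuous_on UNIV (\<lambda>x. \<phi> (apply_bcontfun f x))"
      by (rule continuous_on_compose2[OF bounded_lipschitz_tests_continuous[OF \<phi>, of UNIV]]) auto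
    from LIMSEQ_subseq_LIMSEQ[OF weak[OF this] r] show ?thesis by (simp add: comp_def)
  qed
  then have lim: "(\<lambda>n. ?X n f) \<longlonglongrightarrow> ?Y f" for f by (intro tendsto_intros a)
  have cont: "continuous_on UNIV (?E n)" for n
    by (intro nonexpansive_continuous_on pmf_expectation_compose_lipschitz \<phi>)
  have X_meas: "?X n \<in> borel_measurable \<mu>" for n
  proof -
    have "continuous_on Homeo (?X n)"
      by (intro continuous_intros continuous_on_subset[OF cont]) auto
    from borel_measurable_continuous_on_restrict[OF this] show ?thesis
      using \<mu> measurable_cong_sets by (fastforce simp: borel_prob_def)
  qed
  have Y_meas: "?Y \<in> borel_measurable \<mu>"
    by (rule borel_measurable_LIMSEQ_real[OF lim X_meas])
  have X_le: "?X n f \<le> 2" for n f by (rule bdd_above_discrepancy(1)[OF \<alpha> \<phi>])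
  have Y_le: "?Y f \<le> 2" for f by (rule LIMSEQ_le_const2[OF lim]) (use X_le in blast)
  have "(\<lambda>n. LINT f|\<mu>. ?X n f) \<longlonglongrightarrow> (LINT f|\<mu>. ?Y f)"
    using X_le by (intro integral_dominated_convergence[where w = "\<lambda>_. 2"] X_meas Y_meas AE_I2 lim) auto
  moreover have "(\<lambda>n. LINT f|\<mu>. ?X n f) \<longlonglongrightarrow> 0"
  proof (rule tendsto_sandwich[OF _ _ tendsto_const])
    show "(\<lambda>n. LINT f|\<mu>. discrepancy (p (r n)) (\<alpha> (r n)) f) \<longlonglongrightarrow> 0"
      using LIMSEQ_subseq_LIMSEQ[OF small r] by (simp add: comp_def)
    show "\<forall>\<^sub>F n in sequentially. 0 \<le> (LINT f|\<mu>. ?X n f)"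
      by (intro always_eventually allI integral_nonneg_AE AE_I2) simp
    show "\<forall>\<^sub>F n in sequentially. (LINT f|\<mu>. ?X n f) \<le> (LINT f|\<mu>. discrepancy (p (r n)) (\<alpha> (r n)) f)"
    proof (intro always_eventually allI integral_mono)
      fix n
      show "integrable \<mu> (?X n)"
        using X_meas X_le by (intro \<mu>.integrable_const_bound[of _ 2]) auto
      show "integrable \<mu> (discrepancy (p (r n)) (\<alpha> (r n)))"
        by (rule bounded_nonexpansive_integrable[OF discrepancy_bounded_nonexpansive[OF \<alpha>] \<mu>])
      show "?X n f \<le> discrepancy (p (r n)) (\<alpha> (r n)) f" for f
        unfolding discrepancy_def by (rule cSUP_upper[OF \<phi> bdd_above_discrepancy(2)[OF \<alpha>]])
    qed
  qed
  ultimately have "(LINT f|\<mu>. ?Y f) = 0" by (rule LIMSEQ_unique)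
  moreover have "integrable \<mu> ?Y"
    using Y_meas Y_le by (intro \<mu>.integrable_const_bound[of _ 2]) auto
  ultimately have "AE f in \<mu>. ?Y f = 0"
    by (subst (asm) integral_nonneg_eq_0_iff_AE) auto
  then show ?thesis by (intro exI[of _ a]) (auto elim: AE_mp)
qed

text \<open>
  The exceptional null set depends on \<open>\<phi>\<close>. It is made uniform by passing to the values on closed
  sets, which are limits of integrals of countably many test functions, and then to a countable
  generator of the Borel sets.
\<close>

lemma pushforward_AE_const:
  assumes const: "\<And>\<phi>. \<phi> \<in> bounded_lipschitz_tests \<Longrightarrow> \<exists>a. AE f in \<mu>. (LINT x|\<rho>. \<phi> (apply_bcontfun f x)) = a"
  shows "\<exists>\<nu>'\<in>borel_prob UNIV. AE f in \<mu>. distr \<rho> borel (apply_bcontfun f) = \<nu>'"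
proof -
  have f_meas: "apply_bcontfun f \<in> borel_measurable \<rho>" for f :: "'a \<Rightarrow>\<^sub>C 'a"
    by (rule continuous_borel_prob_measurable[OF \<rho>]) simp
  have distr_prob: "distr \<rho> borel (apply_bcontfun f) \<in> borel_prob UNIV" for f :: "'a \<Rightarrow>\<^sub>C 'a"
    using \<rho>.prob_space_distr[OF f_meas] by (simp add: borel_prob_def)
  have closed_const: "\<exists>a. AE f in \<mu>. measure (distr \<rho> borel (apply_bcontfun f)) C = a"
    if C: "closed C" for C
  proof (cases "C = {}")
    case True
    then show ?thesis by auto
  next
    case False
    \<comment> \<open>the approximations of the indicator of \<open>C\<close>, scaled to Lipschitz constant \<open>1\<close>\<close>
    let ?\<phi> = "\<lambda>k x. max 0 (1 - real (Suc k) * infdist x C) / real (Suc k)"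
    have bl: "?\<phi> k \<in> bounded_lipschitz_tests" for k
    proof -
      define t where "t = inverse (real (Suc k))"
      have t: "0 < t" "t \<le> 1" by (simp_all add: t_def field_simps)
      have \<phi>: "?\<phi> k x = max 0 (t - infdist x C)" for x
        by (simp add: t_def max_def field_simps del: of_nat_Suc)
      have "\<bar>max 0 (t - infdist x C) - max 0 (t - infdist y C)\<bar> \<le> dist x y" for x y
        using infdist_triangle_abs[of x C y] by linarith
      moreover have "\<bar>max 0 (t - infdist x C)\<bar> \<le> 1" for x
        using t infdist_nonneg[of x C] by linarith
      ultimately show ?thesis unfolding bounded_lipschitz_tests_def \<phi> by blast
    qed
    obtain a where a: "AE f in \<mu>. (LINT x|\<rho>. ?\<phi> k (apply_bcontfun f x)) = a k" for k
      using const[OF bl] by metis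
    have "AE f in \<mu>. \<forall>k. (LINT x|\<rho>. ?\<phi> k (apply_bcontfun f x)) = a k"
      using a by (simp add: AE_all_countable)
    then have "AE f in \<mu>. measure (distr \<rho> borel (apply_bcontfun f)) C = lim (\<lambda>k. real (Suc k) * a k)"
    proof (rule AE_mp, intro AE_I2 impI)
      fix f assume f: "\<forall>k. (LINT x|\<rho>. ?\<phi> k (apply_bcontfun f x)) = a k"
      have "(LINT x|\<rho>. max 0 (1 - real (Suc k) * infdist (apply_bcontfun f x) C)) = real (Suc k) * a k" for k
        using f[rule_format, of k] by (simp add: field_simps del: of_nat_Suc)
      with lebesgue_closed_approx[OF \<rho>.prob_space_axioms f_meas[of f] C False]
      have "(\<lambda>k. real (Suc k) * a k) \<longlonglongrightarrow> measure \<rho> (apply_bcontfun f -` C \<inter> space \<rho>)"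
        by (simp del: of_nat_Suc)
      then show "measure (distr \<rho> borel (apply_bcontfun f)) C = lim (\<lambda>k. real (Suc k) * a k)"
        using C by (simp add: measure_distr[OF f_meas] limI)
    qed
    then show ?thesis by blast
  qed
  obtain G :: "'a set set" where G: "countable G" "\<And>C. C \<in> G \<Longrightarrow> closed C" "Int_stable G" "UNIV \<in> G"
      "sets borel = sigma_sets UNIV G"
    using countable_closed_generator[OF X] by blast
  obtain b where b: "\<And>C. C \<in> G \<Longrightarrow> AE f in \<mu>. measure (distr \<rho> borel (apply_bcontfun f)) C = b C"
    using closed_const[OF G(2)] by metis
  have AE_G: "AE f in \<mu>. \<forall>C\<in>G. measure (distr \<rho> borel (apply_bcontfun f)) C = b C"
    using b by (simp add: AE_ball_countable[OF G(1)])
  obtain f0 where f0: "\<forall>C\<in>G. measure (distr \<rho> borel (apply_bcontfun f0)) C = b C"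
    using \<mu>.AE_imp_ex[OF AE_G] by blast
  have "distr \<rho> borel (apply_bcontfun f) = distr \<rho> borel (apply_bcontfun f0)"
    if f: "\<forall>C\<in>G. measure (distr \<rho> borel (apply_bcontfun f)) C = b C" for f
  proof (rule measure_eqI_generator_eq[OF G(3), of UNIV _ _ "\<lambda>_. UNIV"])
    interpret f: prob_space "distr \<rho> borel (apply_bcontfun f)"
      using distr_prob by (simp add: borel_prob_def)
    interpret f0: prob_space "distr \<rho> borel (apply_bcontfun f0)"
      using distr_prob by (simp add: borel_prob_def)
    show "emeasure (distr \<rho> borel (apply_bcontfun f)) C = emeasure (distr \<rho> borel (apply_bcontfun f0)) C"
      if "C \<in> G" for C
      using that f f0 by (simp add: f.emeasure_eq_measure f0.emeasure_eq_measure)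
    show "emeasure (distr \<rho> borel (apply_bcontfun f)) UNIV \<noteq> \<infinity>"
      by (simp add: f.emeasure_eq_measure)
  qed (use G(4,5) in auto)
  with AE_G have "AE f in \<mu>. distr \<rho> borel (apply_bcontfun f) = distr \<rho> borel (apply_bcontfun f0)"
    by (auto elim: AE_mp)
  then show ?thesis using distr_prob by blast
qed

end

text \<open>
  The dichotomy behind both parts, for a single \<open>\<mu>\<close> and an arbitrary class \<open>R\<close> of discrete
  measures: either the mean discrepancy is bounded below on \<open>R\<close>, or some weak limit of members of
  \<open>R\<close> has a deterministic image.
\<close>

lemma vanishing_discrepancy_limit:
  fixes \<mu> :: "('a::metric_space \<Rightarrow>\<^sub>C 'a) measure"
  assumes X: "compact (UNIV :: 'a set)" and \<mu>: "\<mu> \<in> borel_prob Homeo"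
    and none: "\<not> (\<exists>c>0. \<forall>\<rho>\<in>R. \<forall>\<alpha>. (\<forall>\<phi>. \<bar>\<alpha> \<phi>\<bar> \<le> 1) \<longrightarrow> c \<le> (LINT f|\<mu>. discrepancy \<rho> \<alpha> f))"
  obtains p :: "nat \<Rightarrow> 'a pmf" and \<rho> \<nu>' where
    "\<And>n. p n \<in> R" "\<rho> \<in> borel_prob UNIV"
    "\<And>\<phi> :: 'a \<Rightarrow> real. continuous_on UNIV \<phi> \<Longrightarrow>
       (\<lambda>n. measure_pmf.expectation (p n) \<phi>) \<longlonglongrightarrow> (LINT x|\<rho>. \<phi> x)"
    "\<nu>' \<in> borel_prob UNIV" "AE f in \<mu>. distr \<rho> borel (apply_bcontfun f) = \<nu>'"
proof -
  have "\<exists>\<rho>\<in>R. \<exists>\<alpha>. (\<forall>\<phi>. \<bar>\<alpha> \<phi>\<bar> \<le> 1) \<and> (LINT f|\<mu>. discrepancy \<rho> \<alpha> f) < inverse (real (Suc n))" for n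
    using none by (meson inverse_positive_iff_positive not_le of_nat_0_less_iff zero_less_Suc)
  then obtain q \<beta> where q: "\<And>n. q n \<in> R" "\<And>n \<phi>. \<bar>\<beta> n \<phi>\<bar> \<le> 1"
      "\<And>n. (LINT f|\<mu>. discrepancy (q n) (\<beta> n) f) < inverse (real (Suc n))"
    by metis
  obtain r and \<rho> :: "'a measure" where r: "strict_mono r" and \<rho>: "\<rho> \<in> borel_prob UNIV"
    and weak: "\<And>\<phi> :: 'a \<Rightarrow> real. continuous_on UNIV \<phi> \<Longrightarrow>
       (\<lambda>n. measure_pmf.expectation (q (r n)) \<phi>) \<longlonglongrightarrow> (LINT x|\<rho>. \<phi> x)"
    using pmf_weakly_convergent_subsequence[OF X, of q] by blast
  have "(\<lambda>n. LINT f|\<mu>. discrepancy (q n) (\<beta> n) f) \<longlonglongrightarrow> 0"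
  proof (rule tendsto_sandwich[OF _ _ tendsto_const LIMSEQ_inverse_real_of_nat])
    have "0 \<le> discrepancy (q n) (\<beta> n) f" for n f
      using discrepancy_bounded_nonexpansive[of "\<beta> n", OF q(2)] by (simp add: bounded_nonexpansive_def)
    then show "\<forall>\<^sub>F n in sequentially. 0 \<le> (LINT f|\<mu>. discrepancy (q n) (\<beta> n) f)"
      by (intro always_eventually allI integral_nonneg_AE AE_I2)
    show "\<forall>\<^sub>F n in sequentially. (LINT f|\<mu>. discrepancy (q n) (\<beta> n) f) \<le> inverse (real (Suc n))"
      using q(3) by (intro always_eventually allI less_imp_le)
  qed
  from LIMSEQ_subseq_LIMSEQ[OF this r]
  have small: "(\<lambda>n. LINT f|\<mu>. discrepancy (q (r n)) (\<beta> (r n)) f) \<longlonglongrightarrow> 0" by (simp add: comp_def)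
  obtain \<nu>' where "\<nu>' \<in> borel_prob UNIV" "AE f in \<mu>. distr \<rho> borel (apply_bcontfun f) = \<nu>'"
    using pushforward_AE_const[OF X \<mu> \<rho> integral_AE_const[OF X \<mu> \<rho> weak q(2) small]] by blast
  with that[of "\<lambda>n. q (r n)" \<rho>] q(1) \<rho> weak show thesis by blast
qed

text \<open>
  A bijection carries the maximal atoms of \<open>\<rho>\<close> exactly to the atoms of the same weight of the
  image measure. There are only finitely many of them, since they share a positive weight.
\<close>

lemma deterministic_finite_image_if_atom:
  fixes \<mu> :: "('a::metric_space \<Rightarrow>\<^sub>C 'a) measure"
  assumes \<mu>: "\<mu> \<in> borel_prob Homeo" and \<rho>: "\<rho> \<in> borel_prob UNIV"
    and det: "AE f in \<mu>. distr \<rho> borel (apply_bcontfun f) = \<nu>'"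
    and atom: "measure \<rho> {x0} > 0"
  shows "deterministic_finite_image \<mu>"
proof -
  interpret \<mu>: prob_space \<mu> using \<mu> by (simp add: borel_prob_def)
  interpret \<rho>: prob_space \<rho> using \<rho> by (simp add: borel_prob_def)
  obtain x1 where x1: "\<And>y. measure \<rho> {y} \<le> measure \<rho> {x1}" using max_atom_attained[OF \<rho>] by blast
  define m where "m = measure \<rho> {x1}"
  have "m > 0" using atom x1[of x0] by (simp add: m_def)
  define F where "F = {x. measure \<rho> {x} = m}"
  define F' where "F' = {y. measure \<nu>' {y} = m}"
  have "x1 \<in> F" by (simp add: F_def m_def)
  have "finite F"
  proof (rule ccontr)
    assume "infinite F"
    then obtain T where T: "T \<subseteq> F" "finite T" "card T = nat \<lceil>1 / m\<rceil> + 1"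
      using infinite_arbitrarily_large by blast
    have "(\<Sum>x\<in>T. measure \<rho> {x}) = real (card T) * m"
      using T(1) by (subst sum.cong[OF refl, of T _ "\<lambda>_. m"]) (auto simp: F_def)
    moreover have "1 / m < real (card T)" unfolding T(3) by linarith
    then have "1 < real (card T) * m" using \<open>m > 0\<close> by (simp add: field_simps)
    ultimately show False using atoms_sum_le_one[OF \<rho> T(2)] by simp
  qed
  have image: "AE f in \<mu>. apply_bcontfun f ` F = F'"
  proof (rule AE_mp[OF det], intro AE_I2 impI)
    fix f assume "f \<in> space \<mu>" and eq: "distr \<rho> borel (apply_bcontfun f) = \<nu>'"
    then have f: "bij (apply_bcontfun f)" using Homeo_bij by (simp add: space_borel_prob[OF \<mu>])
    have "apply_bcontfun f \<in> borel_measurable \<rho>"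
      by (rule continuous_borel_prob_measurable[OF \<rho>]) simp
    moreover have "apply_bcontfun f -` {apply_bcontfun f x} = {x}" for x
      using bij_is_inj[OF f] by (auto simp: inj_eq)
    ultimately have "measure \<nu>' {apply_bcontfun f x} = measure \<rho> {x}" for x
      by (simp add: eq[symmetric] measure_distr space_borel_prob[OF \<rho>])
    then show "apply_bcontfun f ` F = F'"
      unfolding F_def F'_def using bij_is_surj[OF f] by (auto simp: surj_def image_iff) metis
  qed
  obtain f where "apply_bcontfun f ` F = F'" using \<mu>.AE_imp_ex[OF image] by blast
  then have "finite F'" "F' \<noteq> {}" using \<open>finite F\<close> \<open>x1 \<in> F\<close> by auto
  then show ?thesis
    unfolding deterministic_finite_image_def
    using \<open>finite F\<close> \<open>x1 \<in> F\<close> image by (intro exI[of _ F] exI[of _ F']) auto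
qed

section \<open>Decay of the maximal atom\<close>

text \<open>
  Allowing a restricted class \<open>R\<close> is what makes part (1) possible, where lower bounds for the mean
  discrepancy hold only for measures with a large atom.
\<close>

lemma atom_energy_contracts_uniformly:
  fixes K :: "('a::metric_space \<Rightarrow>\<^sub>C 'a) measure set"
  assumes X: "compact (UNIV :: 'a set)" and K: "compactin (weak_topology Homeo) K"
    and R: "\<And>\<mu>. \<mu> \<in> K \<Longrightarrow>
      \<exists>c>0. \<forall>\<rho>\<in>R. \<forall>\<alpha>. (\<forall>\<phi>. \<bar>\<alpha> \<phi>\<bar> \<le> 1) \<longrightarrow> c \<le> (LINT f|\<mu>. discrepancy \<rho> \<alpha> f)"
  obtains \<kappa> where "0 < \<kappa>" "\<kappa> < 1"
    "\<And>\<mu> \<nu>. \<mu> \<in> K \<Longrightarrow> \<nu> \<in> borel_prob UNIV \<Longrightarrow> (atom_energy \<nu> > 0 \<Longrightarrow> atom_energy_pmf \<nu> \<in> R) \<Longrightarrow>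
       atom_energy (conv \<mu> \<nu>) \<le> \<kappa> * atom_energy \<nu>"
proof -
  define H where "H = {discrepancy \<rho> \<alpha> |\<rho> \<alpha>. \<rho> \<in> R \<and> (\<forall>\<phi>. \<bar>\<alpha> \<phi>\<bar> \<le> 1)}"
  have K_sub: "K \<subseteq> borel_prob Homeo"
    using compactin_subset_topspace[OF K] by (simp add: topspace_weak_topology)
  have "H \<subseteq> bounded_nonexpansive" using discrepancy_bounded_nonexpansive by (auto simp: H_def)
  moreover have "\<exists>c>0. \<forall>h\<in>H. c \<le> (LINT f|\<mu>. h f)" if "\<mu> \<in> K" for \<mu>
    using R[OF that] unfolding H_def by blast
  ultimately obtain c where c: "c > 0" "\<And>\<mu> h. \<mu> \<in> K \<Longrightarrow> h \<in> H \<Longrightarrow> c \<le> (LINT f|\<mu>. h f)"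
    using integral_lower_bound_uniform_on_compact[OF X K, of H] by blast
  \<comment> \<open>the bound \<open>c\<close> may exceed \<open>2\<close>, for instance when \<open>R\<close> is empty, so the factor is kept positive\<close>
  show thesis
  proof (rule that[of "max (1 / 2) (1 - c\<^sup>2 / 4)"])
    show "max (1 / 2) (1 - c\<^sup>2 / 4) < 1" using c(1) by simp
    fix \<mu> and \<nu> :: "'a measure"
    assume \<mu>K: "\<mu> \<in> K" and \<nu>: "\<nu> \<in> borel_prob UNIV" and cls: "atom_energy \<nu> > 0 \<Longrightarrow> atom_energy_pmf \<nu> \<in> R"
    have \<mu>: "\<mu> \<in> borel_prob Homeo" using \<mu>K K_sub by blast
    show "atom_energy (conv \<mu> \<nu>) \<le> max (1 / 2) (1 - c\<^sup>2 / 4) * atom_energy \<nu>"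
    proof (cases "atom_energy \<nu> > 0")
      case True
      have "atom_energy (conv \<mu> \<nu>) \<le> (1 - c\<^sup>2 / 4) * atom_energy \<nu>"
      proof (rule atom_energy_contracts[OF X \<mu> \<nu> c(1)])
        fix \<alpha> :: "('a \<Rightarrow> real) \<Rightarrow> real" assume "\<And>\<phi>. \<bar>\<alpha> \<phi>\<bar> \<le> 1"
        then have "discrepancy (atom_energy_pmf \<nu>) \<alpha> \<in> H" using cls[OF True] by (auto simp: H_def)
        then show "c \<le> (LINT f|\<mu>. discrepancy (atom_energy_pmf \<nu>) \<alpha> f)" by (rule c(2)[OF \<mu>K])
      qed
      also have "\<dots> \<le> max (1 / 2) (1 - c\<^sup>2 / 4) * atom_energy \<nu>"
        using True by (intro mult_right_mono) auto
      finally show ?thesis .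
    next
      case False
      then show ?thesis
        using atom_energy_conv_le[OF X \<mu> \<nu>] atom_energy_nonneg[OF \<nu>] by simp
    qed
  qed simp
qed

lemma max_atom_nonneg: "\<nu> \<in> borel_prob UNIV \<Longrightarrow> 0 \<le> max_atom \<nu>" for \<nu> :: "'a::metric_space measure"
  using max_atom_attained[of \<nu>] by (metis measure_nonneg)

lemma max_atom_square_le_energy:
  "\<nu> \<in> borel_prob UNIV \<Longrightarrow> (max_atom \<nu>)\<^sup>2 \<le> atom_energy \<nu>" for \<nu> :: "'a::metric_space measure"
  using max_atom_attained[of \<nu>] atom_square_le_energy[of \<nu>] by metis

lemma max_atom_conv_le:
  fixes \<nu> :: "'a::metric_space measure"
  assumes X: "compact (UNIV :: 'a set)" and \<mu>: "\<mu> \<in> borel_prob Homeo" and \<nu>: "\<nu> \<in> borel_prob UNIV"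
  shows "max_atom (conv \<mu> \<nu>) \<le> max_atom \<nu>"
proof -
  interpret \<mu>: prob_space \<mu> using \<mu> by (simp add: borel_prob_def)
  obtain y where y: "max_atom (conv \<mu> \<nu>) = measure (conv \<mu> \<nu>) {y}"
    using max_atom_attained[OF conv_in_borel_prob[OF X \<mu> \<nu>]] by blast
  have "(LINT f|\<mu>. measure \<nu> (apply_bcontfun f -` {y})) \<le> (LINT f|\<mu>. max_atom \<nu>)"
  proof (rule integral_mono[OF measure_conv_singleton(1)[OF X \<mu> \<nu>]])
    fix f assume "f \<in> space \<mu>"
    then have "bij (apply_bcontfun f)" using Homeo_bij by (simp add: space_borel_prob[OF \<mu>])
    then obtain x where "apply_bcontfun f -` {y} = {x}"
      by (metis bij_vimage_eq_inv_image image_empty image_insert)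
    then show "measure \<nu> (apply_bcontfun f -` {y}) \<le> max_atom \<nu>"
      using max_atom_attained[OF \<nu>] by auto
  qed simp
  then show ?thesis using measure_conv_singleton(2)[OF X \<mu> \<nu>] y by (simp add: \<mu>.prob_space)
qed

lemma conv_upto_borel_prob:
  assumes "compact (UNIV :: 'a::metric_space set)" "(\<nu> :: 'a measure) \<in> borel_prob UNIV"
    "\<And>i. i \<in> {1..n} \<Longrightarrow> \<mu> i \<in> borel_prob Homeo"
  shows "conv_upto \<mu> \<nu> n \<in> borel_prob UNIV"
  using assms(3) by (induction n) (auto intro!: conv_in_borel_prob assms(1,2))

theorem theorem1p14:
  fixes K :: "('a::metric_space \<Rightarrow>\<^sub>C 'a) measure set"
  assumes "compact (UNIV :: 'a set)"
    and "compactin (weak_topology Homeo) K"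
    and "\<forall>\<mu>\<in>K. \<not> deterministic_finite_image \<mu>"
  shows
    "(\<forall>\<epsilon>>0. \<exists>n\<ge>1. \<forall>\<nu>\<in>borel_prob UNIV. \<forall>\<mu>. (\<forall>i\<in>{1..n}. \<mu> i \<in> K) \<longrightarrow>
        max_atom (conv_upto \<mu> \<nu> n) < \<epsilon>) \<and>
     (\<forall>\<nu>\<in>borel_prob UNIV. \<forall>\<mu>. (\<forall>i\<ge>1. \<mu> i \<in> K) \<longrightarrow>
        (\<lambda>n. max_atom (conv_upto \<mu> \<nu> n)) \<longlonglongrightarrow> 0) \<and>
     ((\<forall>\<mu>\<in>K. \<not> deterministic_measure_image \<mu>) \<longrightarrow>
        (\<exists>r<1. \<forall>n\<ge>1. \<forall>\<nu>\<in>borel_prob UNIV. \<forall>\<mu>. (\<forall>i\<ge>1. \<mu> i \<in> K) \<longrightarrow>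
           max_atom (conv_upto \<mu> \<nu> n) < r ^ n))"
proof -
  note X = assms(1)
  have K: "\<mu> \<in> borel_prob Homeo" if "\<mu> \<in> K" for \<mu>
    using compactin_subset_topspace[OF assms(2)] that by (auto simp: topspace_weak_topology)
  have upto: "conv_upto \<mu> \<nu> n \<in> borel_prob UNIV"
    if "\<nu> \<in> borel_prob UNIV" "\<forall>i\<in>{1..n}. \<mu> i \<in> K" for \<mu> \<nu> n
    using that K by (intro conv_upto_borel_prob X) auto
  have uniform: "\<exists>n\<ge>1. \<forall>\<nu>\<in>borel_prob UNIV. \<forall>\<mu>. (\<forall>i\<in>{1..n}. \<mu> i \<in> K) \<longrightarrow>
      max_atom (conv_upto \<mu> \<nu> n) < \<epsilon>" if \<epsilon>: "\<epsilon> > 0" for \<epsilon>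
  proof -
    \<comment> \<open>if \<open>Max(\<nu>) \<ge> \<epsilon>\<close>, then \<open>\<rho>\<^sub>\<nu>\<close> has an atom of weight at least \<open>\<epsilon>\<^sup>2\<close> because \<open>Q(\<nu>) \<le> 1\<close>\<close>
    define R :: "'a pmf set" where "R = {p. \<exists>x. \<epsilon>\<^sup>2 \<le> pmf p x}"
    have "\<exists>c>0. \<forall>\<rho>\<in>R. \<forall>\<alpha>. (\<forall>\<phi>. \<bar>\<alpha> \<phi>\<bar> \<le> 1) \<longrightarrow> c \<le> (LINT f|\<mu>. discrepancy \<rho> \<alpha> f)" if \<mu>: "\<mu> \<in> K" for \<mu>
    proof (rule ccontr)
      assume "\<not> ?thesis"
      then obtain p :: "nat \<Rightarrow> 'a pmf" and \<rho> \<nu>' where p: "\<And>n. p n \<in> R" and \<rho>: "\<rho> \<in> borel_prob UNIV"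
        and weak: "\<And>\<phi> :: 'a \<Rightarrow> real. continuous_on UNIV \<phi> \<Longrightarrow>
          (\<lambda>n. measure_pmf.expectation (p n) \<phi>) \<longlonglongrightarrow> (LINT x|\<rho>. \<phi> x)"
        and det: "AE f in \<mu>. distr \<rho> borel (apply_bcontfun f) = \<nu>'"
        using vanishing_discrepancy_limit[OF X K[OF \<mu>]] by metis
      obtain x where "\<epsilon>\<^sup>2 \<le> measure \<rho> {x}"
        using weak_limit_atom[OF X \<rho> weak, of "\<epsilon>\<^sup>2"] p by (auto simp: R_def)
      then have "measure \<rho> {x} > 0" using \<epsilon> by (meson less_le_trans zero_less_power)
      from deterministic_finite_image_if_atom[OF K[OF \<mu>] \<rho> det this] show False
        using assms(3) \<mu> by blast
    qed
    then obtain \<kappa> where \<kappa>: "0 < \<kappa>" "\<kappa> < 1"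
      and contr: "\<And>\<mu> \<nu>. \<mu> \<in> K \<Longrightarrow> \<nu> \<in> borel_prob UNIV \<Longrightarrow> (atom_energy \<nu> > 0 \<Longrightarrow> atom_energy_pmf \<nu> \<in> R) \<Longrightarrow>
         atom_energy (conv \<mu> \<nu>) \<le> \<kappa> * atom_energy \<nu>"
      using atom_energy_contracts_uniformly[OF X assms(2), of R] by metis
    obtain n0 where n0: "\<kappa> ^ n0 < \<epsilon>\<^sup>2" using real_arch_pow_inv[of "\<epsilon>\<^sup>2" \<kappa>] \<epsilon> \<kappa> by auto
    define n where "n = Suc n0"
    have "\<kappa> ^ n \<le> \<kappa> ^ n0" using \<kappa> by (intro power_decreasing) (auto simp: n_def)
    then have n: "\<kappa> ^ n < \<epsilon>\<^sup>2" using n0 by linarith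
    show ?thesis
    proof (intro exI[of _ n] conjI ballI allI impI)
      show "1 \<le> n" by (simp add: n_def)
      fix \<nu> :: "'a measure" and \<mu> :: "nat \<Rightarrow> ('a \<Rightarrow>\<^sub>C 'a) measure"
      assume \<nu>: "\<nu> \<in> borel_prob UNIV" and \<mu>: "\<forall>i\<in>{1..n}. \<mu> i \<in> K"
      \<comment> \<open>a large atom at time \<open>m\<close> forces one at all earlier times, so the energy has contracted in every step\<close>
      have energy: "atom_energy (conv_upto \<mu> \<nu> m) \<le> \<kappa> ^ m"
        if "m \<le> n" "\<epsilon> \<le> max_atom (conv_upto \<mu> \<nu> m)" for m
        using that
      proof (induction m)
        case 0
        then show ?case using atom_energy_le_one[OF \<nu>] by simp
      next
        case (Suc m)
        let ?\<nu> = "conv_upto \<mu> \<nu> m"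
        have \<nu>m: "?\<nu> \<in> borel_prob UNIV" using upto[OF \<nu>] \<mu> Suc.prems(1) by auto
        have \<mu>m: "\<mu> (Suc m) \<in> K" using \<mu> Suc.prems(1) by auto
        have big: "\<epsilon> \<le> max_atom ?\<nu>"
          using Suc.prems(2) max_atom_conv_le[OF X K[OF \<mu>m] \<nu>m] by simp
        have "atom_energy_pmf ?\<nu> \<in> R" if pos: "atom_energy ?\<nu> > 0"
        proof -
          obtain x where x: "max_atom ?\<nu> = measure ?\<nu> {x}" using max_atom_attained[OF \<nu>m] by blast
          have "\<epsilon>\<^sup>2 \<le> (measure ?\<nu> {x})\<^sup>2" using big \<epsilon> x by (intro power_mono) auto
          also have "\<dots> \<le> (measure ?\<nu> {x})\<^sup>2 / atom_energy ?\<nu>"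
            using pos atom_energy_le_one[OF \<nu>m] by (simp add: pos_le_divide_eq mult_left_le)
          finally show ?thesis by (auto simp: R_def pmf_atom_energy_pmf[OF \<nu>m pos])
        qed
        from contr[OF \<mu>m \<nu>m this] have "atom_energy (conv_upto \<mu> \<nu> (Suc m)) \<le> \<kappa> * atom_energy ?\<nu>"
          by simp
        also have "\<dots> \<le> \<kappa> * \<kappa> ^ m" using Suc.IH Suc.prems(1) big \<kappa>(1) by (intro mult_left_mono) auto
        finally show ?case by simp
      qed
      show "max_atom (conv_upto \<mu> \<nu> n) < \<epsilon>"
      proof (rule ccontr)
        assume "\<not> max_atom (conv_upto \<mu> \<nu> n) < \<epsilon>"
        then have big: "\<epsilon> \<le> max_atom (conv_upto \<mu> \<nu> n)" by simp
        then have "\<epsilon>\<^sup>2 \<le> (max_atom (conv_upto \<mu> \<nu> n))\<^sup>2" using \<epsilon> by (intro power_mono) auto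
        also have "\<dots> \<le> \<kappa> ^ n"
          using max_atom_square_le_energy[OF upto[OF \<nu> \<mu>]] energy[OF order_refl big] by linarith
        finally show False using n by simp
      qed
    qed
  qed
  moreover have "(\<lambda>n. max_atom (conv_upto \<mu> \<nu> n)) \<longlonglongrightarrow> 0"
    if \<nu>: "\<nu> \<in> borel_prob UNIV" and \<mu>: "\<forall>i\<ge>1. \<mu> i \<in> K" for \<nu> \<mu>
  proof -
    have \<nu>n: "conv_upto \<mu> \<nu> n \<in> borel_prob UNIV" for n using upto[OF \<nu>] \<mu> by auto
    have dec: "decseq (\<lambda>n. max_atom (conv_upto \<mu> \<nu> n))"
      using \<mu> \<nu>n by (intro decseq_SucI) (auto intro!: max_atom_conv_le X K)
    show ?thesis
    proof (rule LIMSEQ_I)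
      fix \<epsilon> :: real assume "\<epsilon> > 0"
      then obtain n where n: "max_atom (conv_upto \<mu> \<nu> n) < \<epsilon>" using uniform \<nu> \<mu> by (metis atLeastAtMost_iff)
      have "norm (max_atom (conv_upto \<mu> \<nu> k) - 0) < \<epsilon>" if "n \<le> k" for k
        using decseqD[OF dec that] n max_atom_nonneg[OF \<nu>n[of k]] by simp
      then show "\<exists>no. \<forall>k\<ge>no. norm (max_atom (conv_upto \<mu> \<nu> k) - 0) < \<epsilon>" by blast
    qed
  qed
  moreover have "\<exists>r<1. \<forall>n\<ge>1. \<forall>\<nu>\<in>borel_prob UNIV. \<forall>\<mu>. (\<forall>i\<ge>1. \<mu> i \<in> K) \<longrightarrow>
      max_atom (conv_upto \<mu> \<nu> n) < r ^ n"
    if nodet: "\<forall>\<mu>\<in>K. \<not> deterministic_measure_image \<mu>"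
  proof -
    have "\<exists>c>0. \<forall>\<rho>\<in>UNIV. \<forall>\<alpha>. (\<forall>\<phi>. \<bar>\<alpha> \<phi>\<bar> \<le> 1) \<longrightarrow> c \<le> (LINT f|\<mu>. discrepancy \<rho> \<alpha> f)" if \<mu>: "\<mu> \<in> K" for \<mu>
    proof (rule ccontr)
      assume "\<not> ?thesis"
      then obtain \<rho> \<nu>' :: "'a measure" where "\<rho> \<in> borel_prob UNIV" "\<nu>' \<in> borel_prob UNIV"
        "AE f in \<mu>. distr \<rho> borel (apply_bcontfun f) = \<nu>'"
        using vanishing_discrepancy_limit[OF X K[OF \<mu>]] by metis
      then show False using nodet \<mu> unfolding deterministic_measure_image_def by blast
    qed
    then obtain \<kappa> where \<kappa>: "0 < \<kappa>" "\<kappa> < 1"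
      and contr: "\<And>\<mu> \<nu>. \<mu> \<in> K \<Longrightarrow> \<nu> \<in> borel_prob UNIV \<Longrightarrow>
         atom_energy (conv \<mu> \<nu>) \<le> \<kappa> * atom_energy \<nu>"
      using atom_energy_contracts_uniformly[OF X assms(2), of UNIV] by (metis UNIV_I)
    \<comment> \<open>any \<open>r < 1\<close> with \<open>r\<^sup>2 > \<kappa>\<close> works; the slack gives the strict inequality\<close>
    define r where "r = sqrt ((1 + \<kappa>) / 2)"
    have r: "0 < r" "r < 1" "\<kappa> < r\<^sup>2" using \<kappa> by (auto simp: r_def)
    show ?thesis
    proof (intro exI[of _ r] conjI allI ballI impI r(2))
      fix n :: nat and \<nu> :: "'a measure" and \<mu> :: "nat \<Rightarrow> ('a \<Rightarrow>\<^sub>C 'a) measure"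
      assume "1 \<le> n" and \<nu>: "\<nu> \<in> borel_prob UNIV" and \<mu>: "\<forall>i\<ge>1. \<mu> i \<in> K"
      have \<nu>n: "conv_upto \<mu> \<nu> n \<in> borel_prob UNIV" for n using upto[OF \<nu>] \<mu> by auto
      have "atom_energy (conv_upto \<mu> \<nu> n) \<le> \<kappa> ^ n"
      proof (induction n)
        case 0
        then show ?case using atom_energy_le_one[OF \<nu>] by simp
      next
        case (Suc n)
        have "atom_energy (conv_upto \<mu> \<nu> (Suc n)) \<le> \<kappa> * atom_energy (conv_upto \<mu> \<nu> n)"
          using contr \<mu> \<nu>n by simp
        also have "\<dots> \<le> \<kappa> * \<kappa> ^ n" using Suc \<kappa>(1) by (intro mult_left_mono) auto
        finally show ?case by simp
      qed
      then have "(max_atom (conv_upto \<mu> \<nu> n))\<^sup>2 \<le> \<kappa> ^ n"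
        using max_atom_square_le_energy[OF \<nu>n[of n]] by linarith
      also have "\<dots> < (r\<^sup>2) ^ n" using \<open>1 \<le> n\<close> \<kappa>(1) r(3) by (intro power_strict_mono) auto
      also have "\<dots> = (r ^ n)\<^sup>2" by (simp add: mult.commute flip: power_mult)
      finally show "max_atom (conv_upto \<mu> \<nu> n) < r ^ n"
        by (rule power_less_imp_less_base) (use r(1) in simp)
    qed
  qed
  ultimately show ?thesis by blast
qed

end
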